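(* For $0\leq k \leq r$, the Chern class $c_k(S_M)$ of the tautological subbundle $S_M$ is given by $$c_k(S_M)=\sum \alpha_S(S_1, \dots, S_t, p_1, \dots, p_t) \, x_{S_1}^{p_1}x_{S_2}^{p_2}\cdots x_{S_t}^{p_t} \quad \in A^k(U_{n,n}),$$ where the sum is taken over all chains of subsets $\emptyset \subsetneq S_1 \subsetneq \cdots \subsetneq S_t \subseteq E$ and all positive integers $p_1, \dots,p_t$ satisfying $\sum_{i=1}^t p_i = k$, with coefficients $$\alpha_S(S_1, \dots, S_t, p_1, \dots, p_t) =(-1)^k\binom{\mathrm{rk}(S_1)}{p_1}\binom{\mathrm{rk}(S_2)-\tilde{p}_1}{p_2}\cdots\binom{\mathrm{rk}(S_t)-\tilde{p}_{t-1}}{p_t},$$ where $\tilde{p}_i=\sum_{j=1}^ip_j$. Similarly, for $0\leq k \leq n-r$, the Chern class $c_k(Q_M)$ of the tautological quotient bundle $Q_M$ is given by $$c_k(Q_M) = \sum \alpha_Q(S_1, \dots, S_t, p_1, \dots, p_t) \, x_{S_1}^{p_1}x_{S_2}^{p_2}\cdots x_{S_t}^{p_t} \quad \in A^k(U_{n,n}),$$ with the sum over the same chains and exponents, and coefficients $$\alpha_Q(S_1, \dots, S_t, p_1, \dots, p_t) =(-1)^k\binom{\mathrm{null}(S_1)}{p_1}\binom{\mathrm{null}(S_2)-\tilde{p}_1}{p_2}\cdots\binom{\mathrm{null}(S_t)-\tilde{p}_{t-1}}{p_t}.$$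
   Context: Let $M$ be a matroid of rank $r$ on the set $E=[n]$, with rank function $\mathrm{rk}$ and nullity function $\mathrm{null}(S)=|S|-\mathrm{rk}(S)$. Let $A^*(U_{n,n})=\mathbb{Z}[x_S : \emptyset \neq S \subseteq [n]]/(\langle x_S x_T : S\not\subseteq T,\ T\not\subseteq S\rangle+\langle \sum_{S\ni e}x_S : e\in[n]\rangle)$ be the Chow ring of the permutohedral toric variety. $S_M$ and $Q_M$ denote the tautological sub and quotient $K$-classes of $M$ (Berget–Eur–Spink–Tseng), and $c_k$ their non-equivariant Chern classes in $A^*(U_{n,n})$. *)

theory Defs
  imports
    "HOL-Library.Poly_Mapping"
    "HOL-Computational_Algebra.Formal_Power_Series"
    "HOL-Combinatorics.Permutations"
    "HOL-Algebra.QuotRing"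
begin

section \<open>Matroids\<close>

definition matroid :: "'a set \<Rightarrow> 'a set set \<Rightarrow> bool" where
  "matroid E I \<longleftrightarrow>
     finite E \<and> I \<subseteq> Pow E \<and> {} \<in> I \<and>
     (\<forall>X\<in>I. \<forall>Y. Y \<subseteq> X \<longrightarrow> Y \<in> I) \<and>
     (\<forall>X\<in>I. \<forall>Y\<in>I. card X < card Y \<longrightarrow> (\<exists>y\<in>Y - X. insert y X \<in> I))"

definition bases :: "'a set set \<Rightarrow> 'a set set" where
  "bases I = {B \<in> I. \<forall>X\<in>I. B \<subseteq> X \<longrightarrow> X = B}"

definition rank :: "'a set set \<Rightarrow> 'a set \<Rightarrow> nat" where
  "rank I S = Max (card ` {X \<in> I. X \<subseteq> S})"

definition nullity :: "'a set set \<Rightarrow> 'a set \<Rightarrow> nat" where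
  "nullity I S = card S - rank I S"

text \<open>The lexicographically first basis for the order
  \<open>\<sigma> 1 < \<sigma> 2 < \<dots> < \<sigma> n\<close> of the ground set.
  All bases have the same size, so of two distinct bases the one that comes first is the one
  containing the first element at which they differ.\<close>

definition lex_first_basis :: "nat \<Rightarrow> nat set set \<Rightarrow> (nat \<Rightarrow> nat) \<Rightarrow> nat set" where
  "lex_first_basis n I \<sigma> =
     (THE B. B \<in> bases I \<and>
        (\<forall>B'\<in>bases I. B' \<noteq> B \<longrightarrow>
           (\<exists>i\<in>{1..n}. \<sigma> i \<in> B - B' \<and> (\<forall>j\<in>{1..<i}. \<sigma> j \<in> B \<longleftrightarrow> \<sigma> j \<in> B'))))"


section \<open>Polynomial rings and the Chow ring of the permutohedral variety\<close>

text \<open>Exponent vectors of monomials are finitely supported functions, polynomials are finitely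
  supported functions on exponent vectors.\<close>

type_synonym 'v zpoly = "('v \<Rightarrow>\<^sub>0 nat) \<Rightarrow>\<^sub>0 int"

definition var :: "'v \<Rightarrow> 'v zpoly" where
  "var v = Poly_Mapping.single (Poly_Mapping.single v 1) 1"

definition poly_ring :: "'v set \<Rightarrow> 'v zpoly ring" where
  "poly_ring V =
     \<lparr>carrier = {f. \<forall>m\<in>Poly_Mapping.keys f. Poly_Mapping.keys m \<subseteq> V},
      mult = (*), one = 1, zero = 0, add = (+)\<rparr>"

definition homogeneous :: "nat \<Rightarrow> 'v zpoly \<Rightarrow> bool" where
  "homogeneous k f \<longleftrightarrow>
     (\<forall>m\<in>Poly_Mapping.keys f. (\<Sum>v\<in>Poly_Mapping.keys m. Poly_Mapping.lookup m v) = k)"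

definition subst :: "('v \<Rightarrow> 'w zpoly) \<Rightarrow> 'v zpoly \<Rightarrow> 'w zpoly" where
  "subst \<phi> f =
     (\<Sum>m\<in>Poly_Mapping.keys f. of_int (Poly_Mapping.lookup f m) *
        (\<Prod>v\<in>Poly_Mapping.keys m. \<phi> v ^ Poly_Mapping.lookup m v))"

definition nonempty_subsets :: "nat \<Rightarrow> nat set set" where
  "nonempty_subsets n = {S. S \<noteq> {} \<and> S \<subseteq> {1..n}}"

text \<open>The polynomial ring on variables \<open>x\<^sub>S\<close>, the ideal of relations, and the quotient
  ring \<open>A\<^sup>*(U\<^sub>n\<^sub>,\<^sub>n)\<close>.  The variable of the full set is included.\<close>

abbreviation x_ring :: "nat \<Rightarrow> nat set zpoly ring" where
  "x_ring n \<equiv> poly_ring (nonempty_subsets n)"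

definition chow_ideal :: "nat \<Rightarrow> nat set zpoly set" where
  "chow_ideal n = Idl\<^bsub>x_ring n\<^esub>
     ({var S * var T | S T. S \<in> nonempty_subsets n \<and> T \<in> nonempty_subsets n \<and>
                            \<not> S \<subseteq> T \<and> \<not> T \<subseteq> S} \<union>
      {\<Sum>S\<in>{S \<in> nonempty_subsets n. e \<in> S}. var S | e. e \<in> {1..n}})"

definition chow_ring :: "nat \<Rightarrow> nat set zpoly set ring" where
  "chow_ring n = x_ring n Quot chow_ideal n"

definition chow_residue :: "nat \<Rightarrow> nat set zpoly \<Rightarrow> nat set zpoly set" where
  "chow_residue n f = chow_ideal n +>\<^bsub>x_ring n\<^esub> f"

definition chow_graded :: "nat \<Rightarrow> nat \<Rightarrow> nat set zpoly set set" where
  "chow_graded n k = chow_residue n ` {f \<in> carrier (x_ring n). homogeneous k f}"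

lemma cring_poly_ring: "cring (poly_ring V)"
proof -
  have mult: "f * g \<in> carrier (poly_ring V)"
    if fg: "f \<in> carrier (poly_ring V)" "g \<in> carrier (poly_ring V)" for f g
  proof -
    have "Poly_Mapping.keys m \<subseteq> V" if "m \<in> Poly_Mapping.keys (f * g)" for m
    proof -
      from that obtain a b where
        "m = a + b" "a \<in> Poly_Mapping.keys f" "b \<in> Poly_Mapping.keys g"
        using keys_mult[of f g] by blast
      then show ?thesis using fg keys_add[of a b] by (fastforce simp: poly_ring_def)
    qed
    then show ?thesis by (simp add: poly_ring_def)
  qed
  have add: "f + g \<in> carrier (poly_ring V)"
    if "f \<in> carrier (poly_ring V)" "g \<in> carrier (poly_ring V)" for f g
    using that keys_add[of f g] by (fastforce simp: poly_ring_def)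
  have minus: "- f \<in> carrier (poly_ring V)" if "f \<in> carrier (poly_ring V)" for f
    using that by (simp add: poly_ring_def)
  have zero: "0 \<in> carrier (poly_ring V)" and one: "1 \<in> carrier (poly_ring V)"
    by (simp_all add: poly_ring_def)
  have ops: "mult (poly_ring V) = (*)" "one (poly_ring V) = 1"
    "ring.zero (poly_ring V) = 0" "ring.add (poly_ring V) = (+)"
    by (simp_all add: poly_ring_def)
  show ?thesis
  proof (intro cringI abelian_groupI comm_monoidI; unfold ops)
    show "\<exists>g\<in>carrier (poly_ring V). g + f = 0" if "f \<in> carrier (poly_ring V)" for f
      using minus[OF that] by (intro bexI[of _ "- f"]) simp_all
  qed (simp_all add: mult add zero one algebra_simps)
qed


section \<open>Equivariant K-classes and Chern classes by localization\<close>

text \<open>Let \<open>T\<close> be the torus \<open>(\<complex>\<^sup>*)\<^sup>n\<close>.  The \<open>T\<close>-fixed points of the permutohedral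
  variety correspond to the permutations \<open>\<sigma>\<close> of \<open>{1..n}\<close>; the cone of \<open>\<sigma>\<close> is spanned by the
  indicator vectors of the sets \<open>\<sigma> ` {1..i}\<close>.
  Restriction to the fixed points is injective on \<open>T\<close>-equivariant K-theory, with image the
  following families of Laurent polynomials in \<open>T\<^sub>1, \<dots>, T\<^sub>n\<close>.
  Values of a family at functions which do not permute \<open>{1..n}\<close> are irrelevant.\<close>

type_synonym laurent = "(nat \<Rightarrow>\<^sub>0 int) \<Rightarrow>\<^sub>0 int"

definition character :: "nat \<Rightarrow> int \<Rightarrow> laurent" where
  "character i a = Poly_Mapping.single (Poly_Mapping.single i a) 1"

definition equivariant_K :: "nat \<Rightarrow> ((nat \<Rightarrow> nat) \<Rightarrow> laurent) set" where
  "equivariant_K n = {\<kappa>. \<forall>\<sigma>. \<sigma> permutes {1..n} \<longrightarrow>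
     (\<forall>m\<in>Poly_Mapping.keys (\<kappa> \<sigma>). Poly_Mapping.keys m \<subseteq> {1..n}) \<and>
     (\<forall>i\<in>{1..<n}. (1 - character (\<sigma> i) 1 * character (\<sigma> (Suc i)) (-1)) dvd
                   (\<kappa> \<sigma> - \<kappa> (\<sigma> \<circ> transpose i (Suc i))))}"

text \<open>Berget--Eur--Spink--Tseng: the tautological sub and quotient classes of a matroid.\<close>

definition taut_sub :: "nat \<Rightarrow> nat set set \<Rightarrow> (nat \<Rightarrow> nat) \<Rightarrow> laurent" where
  "taut_sub n I \<sigma> = (\<Sum>i\<in>lex_first_basis n I \<sigma>. character i (-1))"

definition taut_quot :: "nat \<Rightarrow> nat set set \<Rightarrow> (nat \<Rightarrow> nat) \<Rightarrow> laurent" where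
  "taut_quot n I \<sigma> = (\<Sum>i\<in>{1..n} - lex_first_basis n I \<sigma>. character i (-1))"

text \<open>Both families satisfy the congruences, because \<open>B = lex_first_basis n I \<sigma>\<close> meets every
  initial segment \<open>\<sigma> ` {1..j}\<close> in as many elements as its rank.\<close>

lemma matroidD:
  assumes "matroid E I"
  shows "finite E" "\<And>X. X \<in> I \<Longrightarrow> X \<subseteq> E" "\<And>X. X \<in> I \<Longrightarrow> finite X" "{} \<in> I"
    "\<And>X Y. X \<in> I \<Longrightarrow> Y \<subseteq> X \<Longrightarrow> Y \<in> I"
    "\<And>X Y. X \<in> I \<Longrightarrow> Y \<in> I \<Longrightarrow> card X < card Y \<Longrightarrow> \<exists>y\<in>Y - X. insert y X \<in> I"
proof -
  note M = assms[unfolded matroid_def]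
  show fin: "finite E" and "{} \<in> I" using M by blast+
  show sub: "X \<subseteq> E" if "X \<in> I" for X using M that by blast
  show "finite X" if "X \<in> I" for X using sub[OF that] fin by (rule finite_subset)
  show "Y \<in> I" if "X \<in> I" "Y \<subseteq> X" for X Y using M that by blast
  show "\<exists>y\<in>Y - X. insert y X \<in> I" if "X \<in> I" "Y \<in> I" "card X < card Y" for X Y
    using M that by blast
qed

lemma finite_matroid: "matroid E I \<Longrightarrow> finite I"
  unfolding matroid_def by (meson finite_Pow_iff finite_subset)

lemma card_le_rank:
  assumes "matroid E I" "X \<in> I" "X \<subseteq> S" shows "card X \<le> rank I S"
  unfolding rank_def using assms finite_matroid[OF assms(1)] by (intro Max_ge) auto

lemma rank_witness:
  assumes "matroid E I" shows "\<exists>X\<in>I. X \<subseteq> S \<and> card X = rank I S"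
proof -
  have "rank I S \<in> card ` {X \<in> I. X \<subseteq> S}"
    unfolding rank_def using finite_matroid[OF assms] matroidD(4)[OF assms] by (intro Max_in) auto
  then show ?thesis by auto
qed

lemma greedy_independent:
  fixes n j :: nat
  assumes M: "matroid {1..n} I" and p: "\<sigma> permutes {1..n}" and "j \<le> n"
  shows "\<exists>X\<in>I. X \<subseteq> \<sigma> ` {1..j} \<and> (\<forall>i\<le>j. card (X \<inter> \<sigma> ` {1..i}) = rank I (\<sigma> ` {1..i}))"
  using \<open>j \<le> n\<close>
proof (induction j)
  case 0
  obtain X where "X \<in> I" "X \<subseteq> \<sigma> ` {1..0}" "card X = rank I (\<sigma> ` {1..0})"
    using rank_witness[OF M] by blast
  then show ?case by (intro bexI[of _ X]) auto
next
  case (Suc j)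
  let ?S = "\<lambda>i. \<sigma> ` {1..i}"
  have SucS: "?S (Suc j) = insert (\<sigma> (Suc j)) (?S j)"
    by (simp add: atLeastAtMostSuc_conv)
  have inj: "inj \<sigma>" using p permutes_inj by blast
  obtain X where X: "X \<in> I" "X \<subseteq> ?S j" "\<forall>i\<le>j. card (X \<inter> ?S i) = rank I (?S i)"
    using Suc by auto
  have cX: "card X = rank I (?S j)" using X(2) X(3)[rule_format, of j] by (simp add: Int_absorb2)
  obtain Y where Y: "Y \<in> I" "Y \<subseteq> ?S (Suc j)" "card Y = rank I (?S (Suc j))"
    using rank_witness[OF M] by blast
  have le: "card X \<le> card Y"
    using card_le_rank[OF M X(1), of "?S (Suc j)"] X(2) SucS Y(3) by auto
  show ?case
  proof (cases "card X = card Y")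
    case True
    have "X \<inter> ?S (Suc j) = X" using X(2) SucS by blast
    then have "\<forall>i\<le>Suc j. card (X \<inter> ?S i) = rank I (?S i)"
      using X(3) Y(3) True by (simp add: le_Suc_eq)
    moreover have "X \<subseteq> ?S (Suc j)" using X(2) SucS by blast
    ultimately show ?thesis using X(1) by blast
  next
    case False
    then obtain y where y: "y \<in> Y - X" "insert y X \<in> I"
      using matroidD(6)[OF M X(1) Y(1)] le by auto
    have fX: "finite X" using matroidD(3)[OF M X(1)] .
    have "y \<notin> ?S j"
    proof
      assume "y \<in> ?S j"
      then have "card (insert y X) \<le> card X"
        using card_le_rank[OF M y(2), of "?S j"] X(2) cX by auto
      then show False using y fX by auto
    qed
    then have y': "y = \<sigma> (Suc j)" using y(1) Y(2) SucS by blast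
    have "Y - {y} \<in> I" "Y - {y} \<subseteq> ?S j"
      using matroidD(5)[OF M Y(1)] Y(2) SucS y' by auto
    then have "card (Y - {y}) \<le> card X" using card_le_rank[OF M] cX by metis
    then have c: "card (insert y X) = card Y"
      using y fX le False by (simp add: card_Diff_singleton_if split: if_splits)
    have old: "insert y X \<inter> ?S i = X \<inter> ?S i" if "i \<le> j" for i
    proof -
      have "y \<notin> ?S i" using \<open>y \<notin> ?S j\<close> that by auto
      then show ?thesis by blast
    qed
    have sub: "insert y X \<subseteq> ?S (Suc j)" using X(2) SucS y' by auto
    then have new: "insert y X \<inter> ?S (Suc j) = insert y X" by blast
    have "\<forall>i\<le>Suc j. card (insert y X \<inter> ?S i) = rank I (?S i)"
      using old new X(3) c Y(3) by (auto simp only: le_Suc_eq)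
    then show ?thesis using y(2) sub by blast
  qed
qed

lemma lex_first_basis:
  assumes M: "matroid {1..n} I" and p: "\<sigma> permutes {1..n}"
  shows "lex_first_basis n I \<sigma> \<in> bases I"
    and "j \<le> n \<Longrightarrow> card (lex_first_basis n I \<sigma> \<inter> \<sigma> ` {1..j}) = rank I (\<sigma> ` {1..j})"
proof -
  let ?S = "\<lambda>i. \<sigma> ` {1..i}"
  let ?P = "\<lambda>B. B \<in> bases I \<and>
        (\<forall>B'\<in>bases I. B' \<noteq> B \<longrightarrow>
           (\<exists>i\<in>{1..n}. \<sigma> i \<in> B - B' \<and> (\<forall>j\<in>{1..<i}. \<sigma> j \<in> B \<longleftrightarrow> \<sigma> j \<in> B')))"
  have im: "?S n = {1..n}" using p by (rule permutes_image)
  have inj: "inj \<sigma>" using p permutes_inj by blast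
  obtain G where G: "G \<in> I" "\<forall>i\<le>n. card (G \<inter> ?S i) = rank I (?S i)"
    using greedy_independent[OF M p order_refl] by blast
  have GE: "G \<subseteq> {1..n}" using matroidD(2)[OF M G(1)] .
  have basis: "G \<in> bases I"
  proof -
    have "X = G" if "X \<in> I" "G \<subseteq> X" for X
    proof -
      have "card X \<le> card G"
        using card_le_rank[OF M that(1) matroidD(2)[OF M that(1)]] G(2)[rule_format, of n] GE im
        by (simp add: Int_absorb2)
      then show ?thesis using that matroidD(3)[OF M] card_seteq by metis
    qed
    then show ?thesis using G(1) by (auto simp: bases_def)
  qed
  have first: "\<exists>i\<in>{1..n}. \<sigma> i \<in> G - B \<and> (\<forall>j\<in>{1..<i}. \<sigma> j \<in> G \<longleftrightarrow> \<sigma> j \<in> B)"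
    if B: "B \<in> bases I" "B \<noteq> G" for B
  proof -
    have BI: "B \<in> I" and BE: "B \<subseteq> {1..n}"
      using B matroidD(2)[OF M] by (auto simp: bases_def)
    define i where "i = (LEAST i. i \<in> {1..n} \<and> (\<sigma> i \<in> G) \<noteq> (\<sigma> i \<in> B))"
    obtain e where "e \<in> {1..n}" "(e \<in> G) \<noteq> (e \<in> B)" using B(2) GE BE by blast
    then have "\<exists>i. i \<in> {1..n} \<and> (\<sigma> i \<in> G) \<noteq> (\<sigma> i \<in> B)" using im by (metis imageE)
    then have "i \<in> {1..n} \<and> (\<sigma> i \<in> G) \<noteq> (\<sigma> i \<in> B)"
      unfolding i_def by (rule LeastI_ex)
    then have i: "i \<in> {1..n}" "(\<sigma> i \<in> G) \<noteq> (\<sigma> i \<in> B)" by auto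
    have before: "\<sigma> j \<in> G \<longleftrightarrow> \<sigma> j \<in> B" if "j \<in> {1..<i}" for j
      using not_less_Least[of j "\<lambda>i. i \<in> {1..n} \<and> (\<sigma> i \<in> G) \<noteq> (\<sigma> i \<in> B)"] that i(1)
      unfolding i_def[symmetric] by auto
    have "\<sigma> i \<in> G"
    proof (rule ccontr)
      assume n: "\<sigma> i \<notin> G"
      have Si: "?S i = insert (\<sigma> i) (\<sigma> ` {1..<i})"
      proof -
        have "{1..i} = insert i {1..<i}" using i(1) by auto
        then show ?thesis by simp
      qed
      have "G \<inter> ?S i = G \<inter> \<sigma> ` {1..<i}" using n Si by auto
      moreover have "B \<inter> ?S i = insert (\<sigma> i) (G \<inter> \<sigma> ` {1..<i})"
        using n i(2) Si before by auto
      moreover have "card (B \<inter> ?S i) \<le> card (G \<inter> ?S i)"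
      proof -
        have "B \<inter> ?S i \<in> I" using matroidD(5)[OF M BI] by blast
        then show ?thesis using card_le_rank[OF M, of "B \<inter> ?S i" "?S i"] G(2) i(1) by auto
      qed
      ultimately show False using n by auto
    qed
    then show ?thesis using i before by auto
  qed
  have PG: "?P G" using basis first by blast
  have uniq: "B = G" if PB: "?P B" for B
  proof (rule ccontr)
    assume ne: "B \<noteq> G"
    obtain i where i: "i \<in> {1..n}" "\<sigma> i \<in> G - B" "\<forall>j\<in>{1..<i}. \<sigma> j \<in> G \<longleftrightarrow> \<sigma> j \<in> B"
      using first[OF conjunct1[OF PB] ne] by blast
    obtain k where k: "k \<in> {1..n}" "\<sigma> k \<in> B - G" "\<forall>j\<in>{1..<k}. \<sigma> j \<in> B \<longleftrightarrow> \<sigma> j \<in> G"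
      using bspec[OF conjunct2[OF PB] basis] ne[symmetric] by blast
    have "\<not> i < k"
    proof
      assume "i < k"
      then have "\<sigma> i \<in> B \<longleftrightarrow> \<sigma> i \<in> G" using i(1) bspec[OF k(3), of i] by simp
      then show False using i(2) by blast
    qed
    moreover have "\<not> k < i"
    proof
      assume "k < i"
      then have "\<sigma> k \<in> G \<longleftrightarrow> \<sigma> k \<in> B" using k(1) bspec[OF i(3), of k] by simp
      then show False using k(2) by blast
    qed
    moreover have "i \<noteq> k" using i(2) k(2) by blast
    ultimately show False by linarith
  qed
  have "lex_first_basis n I \<sigma> = G"
    unfolding lex_first_basis_def using PG uniq by (rule the_equality)
  then show "lex_first_basis n I \<sigma> \<in> bases I"
    and "j \<le> n \<Longrightarrow> card (lex_first_basis n I \<sigma> \<inter> \<sigma> ` {1..j}) = rank I (\<sigma> ` {1..j})"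
    using basis G(2) by auto
qed

lemma lex_first_basis_subset:
  assumes "matroid {1..n} I" "\<sigma> permutes {1..n}"
  shows "lex_first_basis n I \<sigma> \<subseteq> {1..n}"
proof -
  have "lex_first_basis n I \<sigma> \<in> I" using lex_first_basis(1)[OF assms] by (simp add: bases_def)
  then show ?thesis by (rule matroidD(2)[OF assms(1)])
qed

lemma lex_first_basis_transpose:
  assumes M: "matroid {1..n} I" and p: "\<sigma> permutes {1..n}" and i: "i \<in> {1..<n}"
  defines "a \<equiv> \<sigma> i" and "b \<equiv> \<sigma> (Suc i)"
    and "B \<equiv> lex_first_basis n I \<sigma>"
    and "B' \<equiv> lex_first_basis n I (\<sigma> \<circ> transpose i (Suc i))"
  shows "B - {a, b} = B' - {a, b}" and "card (B \<inter> {a, b}) = card (B' \<inter> {a, b})"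
proof -
  let ?\<tau> = "\<sigma> \<circ> transpose i (Suc i)"
  let ?S = "\<lambda>i. \<sigma> ` {1..i}"
  have inj: "inj \<sigma>" using p permutes_inj by blast
  have p': "?\<tau> permutes {1..n}"
    using i by (intro permutes_compose[OF _ p] permutes_swap_id) auto
  have im: "?\<tau> ` {1..j} = ?S j" if "j \<noteq> i" for j
  proof -
    have "transpose i (Suc i) ` {1..j} = {1..j}"
    proof (cases "i < j")
      case True
      then show ?thesis using i by (intro permutes_image permutes_swap_id) auto
    next
      case False
      then have "transpose i (Suc i) k = k" if "k \<in> {1..j}" for k
        using that \<open>j \<noteq> i\<close> by (auto simp: transpose_def)
      then show ?thesis by auto
    qed
    then show ?thesis by (metis image_comp)
  qed
  have eq: "card (B \<inter> ?S j) = card (B' \<inter> ?S j)" if "j \<le> n" "j \<noteq> i" for j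
    using lex_first_basis(2)[OF M p that(1)] lex_first_basis(2)[OF M p' that(1)] im[OF that(2)]
    by (simp add: B_def B'_def)
  have BE: "B \<subseteq> {1..n}" "B' \<subseteq> {1..n}"
    unfolding B_def B'_def using lex_first_basis_subset M p p' by blast+
  then have fin: "finite B" "finite B'" using finite_subset by auto
  have step: "card (X \<inter> ?S k) = card (X \<inter> ?S (k - 1)) + (if \<sigma> k \<in> X then 1 else 0)"
    if "1 \<le> k" "finite X" for X k
  proof -
    have "{1..k} = insert k {1..k - 1}" using that by auto
    then have S: "?S k = insert (\<sigma> k) (?S (k - 1))" by auto
    have "\<sigma> k \<notin> ?S (k - 1)" using inj that by (auto simp: inj_eq[OF inj])
    then show ?thesis using that unfolding S by (auto simp: Int_insert_right)
  qed
  have mem: "\<sigma> k \<in> B \<longleftrightarrow> \<sigma> k \<in> B'" if k: "k \<in> {1..n}" "k \<noteq> i" "k \<noteq> Suc i" for k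
  proof -
    have "card (B \<inter> ?S k) = card (B' \<inter> ?S k)" "card (B \<inter> ?S (k - 1)) = card (B' \<inter> ?S (k - 1))"
      using k eq[of k] eq[of "k - 1"] by auto
    moreover have "1 \<le> k" using k by simp
    ultimately have "(if \<sigma> k \<in> B then 1 else 0) = (if \<sigma> k \<in> B' then 1 else 0 :: nat)"
      using step[of k B] step[of k B'] fin by linarith
    then show ?thesis by (simp split: if_splits)
  qed
  have "x \<in> B \<longleftrightarrow> x \<in> B'" if "x \<notin> {a, b}" for x
  proof (cases "x \<in> {1..n}")
    case True
    then obtain k where "k \<in> {1..n}" "x = \<sigma> k" using permutes_image[OF p] by (metis imageE)
    then show ?thesis using mem that by (auto simp: a_def b_def)
  qed (use BE in auto)
  then show "B - {a, b} = B' - {a, b}" by blast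
  have two: "card (X \<inter> ?S (Suc i)) = card (X \<inter> ?S (i - 1)) + card (X \<inter> {a, b})"
    if "finite X" for X
  proof -
    have "a \<noteq> b" unfolding a_def b_def by (simp add: inj_eq[OF inj])
    then have "card (X \<inter> {a, b}) = (if a \<in> X then 1 else 0) + (if b \<in> X then 1 else 0)"
      by (auto simp: Int_insert_right)
    then show ?thesis using step[of i X] step[of "Suc i" X] that i by (simp add: a_def b_def)
  qed
  have "card (B \<inter> ?S (Suc i)) = card (B' \<inter> ?S (Suc i))"
    "card (B \<inter> ?S (i - 1)) = card (B' \<inter> ?S (i - 1))"
    using i eq[of "Suc i"] eq[of "i - 1"] by auto
  then show "card (B \<inter> {a, b}) = card (B' \<inter> {a, b})" using two[of B] two[of B'] fin by simp
qed

lemma character_sum_congruence: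
  assumes fin: "finite X" "finite Y" and ne: "a \<noteq> b"
    and eq: "X - {a, b} = Y - {a, b}" "card (X \<inter> {a, b}) = card (Y \<inter> {a, b})"
  shows "(1 - character a 1 * character b (-1)) dvd
    ((\<Sum>i\<in>X. character i (-1)) - (\<Sum>i\<in>Y. character i (-1)))"
proof -
  let ?c = "\<lambda>i. character i (-1)"
  have split: "sum ?c Z = sum ?c (Z - {a, b}) + ((if a \<in> Z then ?c a else 0) + (if b \<in> Z then ?c b else 0))"
    if "finite Z" for Z
  proof -
    have "sum ?c Z = sum ?c (Z - {a, b}) + sum ?c (Z \<inter> {a, b})"
      using sum.Int_Diff[OF that, of ?c "{a, b}"] by simp
    also have "sum ?c (Z \<inter> {a, b}) = (if a \<in> Z then ?c a else 0) + (if b \<in> Z then ?c b else 0)"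
      using ne by (auto simp: Int_insert_right)
    finally show ?thesis .
  qed
  have one: "?c a * character a 1 = 1"
    by (simp add: character_def mult_single single_add[symmetric])
  have key: "?c a * (1 - character a 1 * ?c b) = ?c a - ?c b"
    by (simp add: right_diff_distrib mult.assoc[symmetric] one)
  then have d: "(1 - character a 1 * ?c b) dvd (?c a - ?c b)"
    by (metis dvd_triv_right)
  then have d': "(1 - character a 1 * ?c b) dvd (?c b - ?c a)"
    by (metis dvd_minus_iff minus_diff_eq)
  have card: "card (Z \<inter> {a, b}) = (if a \<in> Z then 1 else 0) + (if b \<in> Z then 1 else 0)" for Z
    using ne by (auto simp: Int_insert_right)
  have diff: "sum ?c X - sum ?c Y =
      ((if a \<in> X then ?c a else 0) + (if b \<in> X then ?c b else 0)) -
      ((if a \<in> Y then ?c a else 0) + (if b \<in> Y then ?c b else 0))"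
    unfolding split[OF fin(1)] split[OF fin(2)] eq(1) by simp
  show ?thesis
    using d d' eq(2)[unfolded card] unfolding diff
    by (cases "a \<in> X"; cases "b \<in> X"; cases "a \<in> Y"; cases "b \<in> Y"; simp)
qed

lemma keys_character_sum:
  assumes "finite X" "m \<in> Poly_Mapping.keys (\<Sum>i\<in>X. character i a)"
  shows "Poly_Mapping.keys m \<subseteq> X"
proof -
  have "m \<in> (\<Union>i\<in>X. Poly_Mapping.keys (character i a))"
    using assms keys_sum by (metis subsetD)
  then show ?thesis by (auto simp: character_def split: if_splits)
qed

lemma taut_in_equivariant_K:
  assumes M: "matroid {1..n} I"
  shows "taut_sub n I \<in> equivariant_K n" and "taut_quot n I \<in> equivariant_K n"
proof -
  have *: "taut_sub n I \<in> equivariant_K n \<and> taut_quot n I \<in> equivariant_K n"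
    unfolding equivariant_K_def mem_Collect_eq
  proof (intro conjI allI impI ballI)
    fix \<sigma> assume p: "\<sigma> permutes {1..n}"
    note sub = lex_first_basis_subset[OF M p]
    then have fin: "finite (lex_first_basis n I \<sigma>)" using finite_subset by blast
    show "Poly_Mapping.keys m \<subseteq> {1..n}" if "m \<in> Poly_Mapping.keys (taut_sub n I \<sigma>)" for m
      using keys_character_sum[OF fin that[unfolded taut_sub_def]] sub by blast
    show "Poly_Mapping.keys m \<subseteq> {1..n}" if "m \<in> Poly_Mapping.keys (taut_quot n I \<sigma>)" for m
      using keys_character_sum[OF _ that[unfolded taut_quot_def]] by auto
    fix i assume i: "i \<in> {1..<n}"
    let ?\<tau> = "\<sigma> \<circ> transpose i (Suc i)"
    let ?B = "lex_first_basis n I \<sigma>" and ?B' = "lex_first_basis n I ?\<tau>"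
    let ?P = "{\<sigma> i, \<sigma> (Suc i)}"
    have p': "?\<tau> permutes {1..n}"
      using i by (intro permutes_compose[OF _ p] permutes_swap_id) auto
    note sub' = lex_first_basis_subset[OF M p']
    then have fin': "finite ?B'" using finite_subset by blast
    have ne: "\<sigma> i \<noteq> \<sigma> (Suc i)" by (simp add: inj_eq[OF permutes_inj[OF p]])
    have P: "?P \<subseteq> {1..n}" using i permutes_in_image[OF p] by auto
    note tr = lex_first_basis_transpose[OF M p i]
    show "(1 - character (\<sigma> i) 1 * character (\<sigma> (Suc i)) (-1)) dvd
        (taut_sub n I \<sigma> - taut_sub n I ?\<tau>)"
      unfolding taut_sub_def by (rule character_sum_congruence[OF fin fin' ne tr])
    have card: "card (({1..n} - Z) \<inter> ?P) = card ?P - card (Z \<inter> ?P)" for Z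
    proof -
      have "({1..n} - Z) \<inter> ?P = ?P - (Z \<inter> ?P)" using P by blast
      then show ?thesis by (simp add: card_Diff_subset)
    qed
    have "({1..n} - ?B) - ?P = ({1..n} - ?B') - ?P" using tr(1) by blast
    moreover have "card (({1..n} - ?B) \<inter> ?P) = card (({1..n} - ?B') \<inter> ?P)"
      unfolding card tr(2) ..
    ultimately show "(1 - character (\<sigma> i) 1 * character (\<sigma> (Suc i)) (-1)) dvd
        (taut_quot n I \<sigma> - taut_quot n I ?\<tau>)"
      unfolding taut_quot_def by (intro character_sum_congruence[OF _ _ ne]) auto
  qed
  then show "taut_sub n I \<in> equivariant_K n" and "taut_quot n I \<in> equivariant_K n" by auto
qed

text \<open>At a fixed point a K-class is \<open>\<Sum>\<^sub>m a\<^sub>m T\<^sup>m\<close>, and its total equivariant Chern class,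
  with a formal variable recording the degree, is the product of the
  \<open>(1 + (\<Sum>\<^sub>i m\<^sub>i t\<^sub>i) X) ^ a\<^sub>m\<close>.  For negative \<open>a\<^sub>m\<close> the inverse is a geometric series.\<close>

definition character_weight :: "(nat \<Rightarrow>\<^sub>0 int) \<Rightarrow> nat zpoly" where
  "character_weight m = (\<Sum>i\<in>Poly_Mapping.keys m. of_int (Poly_Mapping.lookup m i) * var i)"

definition chern_factor :: "nat zpoly \<Rightarrow> int \<Rightarrow> nat zpoly fps" where
  "chern_factor l a =
     (if 0 \<le> a then (1 + fps_const l * fps_X) ^ nat a
      else Abs_fps (\<lambda>k. (- l) ^ k) ^ nat (- a))"

definition equivariant_chern ::
    "nat \<Rightarrow> ((nat \<Rightarrow> nat) \<Rightarrow> laurent) \<Rightarrow> (nat \<Rightarrow> nat) \<Rightarrow> nat zpoly" where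
  "equivariant_chern k \<kappa> \<sigma> =
     fps_nth (\<Prod>m\<in>Poly_Mapping.keys (\<kappa> \<sigma>).
                chern_factor (character_weight m) (Poly_Mapping.lookup (\<kappa> \<sigma>) m)) k"

text \<open>The equivariant Chow ring is the ring of piecewise polynomials on the fan, in coordinates
  \<open>t\<^sub>1, \<dots>, t\<^sub>n\<close>.  Sending \<open>x\<^sub>S\<close> to its Courant function identifies it with the polynomial ring
  in the \<open>x\<^sub>S\<close> modulo the products \<open>x\<^sub>S x\<^sub>T\<close> for incomparable \<open>S, T\<close>.
  The Courant function of \<open>S\<close> is the piecewise linear function that is \<open>1\<close> at the indicator
  vector of \<open>S\<close> and \<open>0\<close> at all other indicator vectors of nonempty sets, so it vanishes on the
  cone of \<open>\<sigma>\<close> unless \<open>S\<close> is an initial segment \<open>\<sigma> ` {1..i}\<close>.  Under this identification the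
  global coordinate \<open>t\<^sub>e\<close> is \<open>\<Sum>\<^bsub>S \<ni> e\<^esub> x\<^sub>S\<close>.\<close>

definition courant :: "nat \<Rightarrow> nat set \<Rightarrow> (nat \<Rightarrow> nat) \<Rightarrow> nat zpoly" where
  "courant n S \<sigma> =
     (if S = \<sigma> ` {1..card S}
      then var (\<sigma> (card S)) - (if card S < n then var (\<sigma> (Suc (card S))) else 0)
      else 0)"

text \<open>Passing to non-equivariant classes is dividing out the \<open>t\<^sub>e\<close>: a piecewise polynomial is
  lifted to a polynomial in the \<open>x\<^sub>S\<close>, whose residue class does not depend on the lift.\<close>

definition nonequivariant :: "nat \<Rightarrow> ((nat \<Rightarrow> nat) \<Rightarrow> nat zpoly) \<Rightarrow> nat set zpoly set" where
  "nonequivariant n g =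
     (THE c. c \<in> carrier (chow_ring n) \<and>
        (\<exists>f\<in>carrier (x_ring n). c = chow_residue n f \<and>
           (\<forall>\<sigma>. \<sigma> permutes {1..n} \<longrightarrow> subst (\<lambda>S. courant n S \<sigma>) f = g \<sigma>)))"

definition chern_class :: "nat \<Rightarrow> nat \<Rightarrow> ((nat \<Rightarrow> nat) \<Rightarrow> laurent) \<Rightarrow> nat set zpoly set" where
  "chern_class n k \<kappa> = nonequivariant n (equivariant_chern k \<kappa>)"


section \<open>Chains with exponents\<close>

text \<open>The chain \<open>S\<^sub>1 \<subset> \<dots> \<subset> S\<^sub>t\<close> and the exponents \<open>p\<^sub>1, \<dots>, p\<^sub>t\<close> are lists of equal length,
  indexed from \<open>0\<close>; \<open>t = 0\<close> is allowed and contributes only for \<open>k = 0\<close>.\<close>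

definition exponent_chains :: "nat \<Rightarrow> nat \<Rightarrow> (nat set list \<times> nat list) set" where
  "exponent_chains n k = {(Ss, ps).
     set Ss \<subseteq> nonempty_subsets n \<and> sorted_wrt (\<subset>) Ss \<and>
     length ps = length Ss \<and> (\<forall>p\<in>set ps. 0 < p) \<and> sum_list ps = k}"

text \<open>Subtraction here is truncated.  For a monotone \<open>\<rho>\<close>, such as rank and nullity, a difference
  can only be negative if the factor of an earlier index vanishes, so the product is the same
  for every convention on binomial coefficients with negative upper entry.\<close>

definition alpha :: "(nat set \<Rightarrow> nat) \<Rightarrow> nat set list \<Rightarrow> nat list \<Rightarrow> int" where
  "alpha \<rho> Ss ps = (-1) ^ sum_list ps *
     (\<Prod>i<length Ss. int ((\<rho> (Ss ! i) - sum_list (take i ps)) choose (ps ! i)))"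

definition chain_monomial :: "nat set list \<Rightarrow> nat list \<Rightarrow> nat set zpoly" where
  "chain_monomial Ss ps = (\<Prod>i<length Ss. var (Ss ! i) ^ (ps ! i))"

end

theory Submission
  imports Defs
begin

text \<open>On the cone of \<open>\<sigma>\<close>, with initial segments \<open>F\<^sub>i = \<sigma> ` {1..i}\<close>, the ring of
  piecewise polynomials is the polynomial ring in the Courant functions \<open>y\<^sub>i\<close> of the \<open>F\<^sub>i\<close>,
  because \<open>t\<^bsub>\<sigma> j\<^esub>\<close> is \<open>y\<^sub>j + \<dots> + y\<^sub>n\<close>.  Every chain of subsets lies in some such flag, so a
  polynomial in the \<open>x\<^sub>S\<close> that vanishes on all cones only has monomials with two incomparable
  sets, and the nonequivariant class is independent of the lift.

  It remains to see that the claimed polynomial lifts the equivariant Chern class, that is, that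
  on each cone it is the elementary symmetric polynomial of the \<open>-t\<^sub>b\<close>, \<open>b\<close> in a set \<open>B\<close> that
  meets \<open>F\<^sub>i\<close> in \<open>\<rho> F\<^sub>i\<close> elements.  Passing from \<open>F\<^sub>m\<close> to \<open>F\<^sub>m\<^sub>+\<^sub>1\<close> shifts all variables
  by \<open>-y\<^sub>m\<^sub>+\<^sub>1\<close>, and in \<open>e\<^sub>k (u + c) = \<Sum>\<^sub>j (N - j choose k - j) c\<^bsup>k-j\<^esup> e\<^sub>j u\<close> the
  summand \<open>j\<close> collects the chains in which \<open>F\<^sub>m\<^sub>+\<^sub>1\<close> has exponent \<open>k - j\<close>.\<close>

section \<open>Substitution\<close>

definition monomial_value :: "('v \<Rightarrow> 'w zpoly) \<Rightarrow> ('v \<Rightarrow>\<^sub>0 nat) \<Rightarrow> 'w zpoly" where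
  "monomial_value \<phi> m = (\<Prod>v\<in>Poly_Mapping.keys m. \<phi> v ^ Poly_Mapping.lookup m v)"

text \<open>Exponents vanish off the support, so each extra factor is 1. This lets several monomials
  be evaluated over one common index set.\<close>

lemma monomial_value_superset:
  assumes "finite A" "Poly_Mapping.keys m \<subseteq> A"
  shows "monomial_value \<phi> m = (\<Prod>v\<in>A. \<phi> v ^ Poly_Mapping.lookup m v)"
  unfolding monomial_value_def
  by (rule prod.mono_neutral_left) (use assms in \<open>auto simp: in_keys_iff\<close>)

lemma monomial_value_0 [simp]: "monomial_value \<phi> 0 = 1"
  by (simp add: monomial_value_def)

lemma monomial_value_single [simp]: "monomial_value \<phi> (Poly_Mapping.single v k) = \<phi> v ^ k"
  by (simp add: monomial_value_def)

lemma monomial_value_add: "monomial_value \<phi> (a + b) = monomial_value \<phi> a * monomial_value \<phi> b"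
proof -
  let ?A = "Poly_Mapping.keys a \<union> Poly_Mapping.keys b"
  have "monomial_value \<phi> c = (\<Prod>v\<in>?A. \<phi> v ^ Poly_Mapping.lookup c v)" if "c \<in> {a, b, a + b}" for c
    by (rule monomial_value_superset) (use that keys_add[of a b] in auto)
  then show ?thesis by (simp add: lookup_add power_add prod.distrib)
qed

lemma subst_monomial_value:
  "subst \<phi> f = (\<Sum>m\<in>Poly_Mapping.keys f. of_int (Poly_Mapping.lookup f m) * monomial_value \<phi> m)"
  by (simp add: subst_def monomial_value_def)

lemma subst_superset:
  assumes "finite A" "Poly_Mapping.keys f \<subseteq> A"
  shows "subst \<phi> f = (\<Sum>m\<in>A. of_int (Poly_Mapping.lookup f m) * monomial_value \<phi> m)"
  unfolding subst_monomial_value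
  by (rule sum.mono_neutral_left) (use assms in \<open>auto simp: in_keys_iff\<close>)

lemma subst_0 [simp]: "subst \<phi> 0 = 0"
  by (simp add: subst_def)

lemma subst_single [simp]:
  "subst \<phi> (Poly_Mapping.single m c) = of_int c * monomial_value \<phi> m"
  by (simp add: subst_monomial_value)

lemma subst_1 [simp]: "subst \<phi> 1 = 1"
  using subst_single[of \<phi> 0 1] by simp

lemma of_int_poly_mapping: "of_int c = Poly_Mapping.single (0 :: 'v \<Rightarrow>\<^sub>0 nat) c"
  by (simp only: single_of_int[symmetric] of_int_eq_id id_apply)

lemma subst_of_int [simp]: "subst \<phi> (of_int c) = of_int c"
  using subst_single[of \<phi> 0 c] by (simp flip: of_int_poly_mapping)

lemma subst_var [simp]: "subst \<phi> (var v) = \<phi> v"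
  by (simp add: var_def)

lemma subst_add: "subst \<phi> (f + g) = subst \<phi> f + subst \<phi> g"
proof -
  let ?A = "Poly_Mapping.keys f \<union> Poly_Mapping.keys g"
  have "subst \<phi> h = (\<Sum>m\<in>?A. of_int (Poly_Mapping.lookup h m) * monomial_value \<phi> m)"
    if "h \<in> {f, g, f + g}" for h
    by (rule subst_superset) (use that keys_add[of f g] in auto)
  then show ?thesis by (simp add: lookup_add distrib_right sum.distrib)
qed

lemma subst_sum: "subst \<phi> (sum f A) = (\<Sum>a\<in>A. subst \<phi> (f a))"
  by (induction A rule: infinite_finite_induct) (simp_all add: subst_add)

lemma subst_diff: "subst \<phi> (f - g) = subst \<phi> f - subst \<phi> g"
  using subst_add[of \<phi> "f - g" g] by simp

lemma poly_mapping_sum_single: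
  "(\<Sum>m\<in>Poly_Mapping.keys f. Poly_Mapping.single m (Poly_Mapping.lookup f m)) = f"
  by (rule poly_mapping_eqI)
    (simp add: lookup_sum lookup_single when_def in_keys_iff)

text \<open>By bilinearity it is enough to multiply single monomials, where the claim is
  \<open>monomial_value_add\<close>.\<close>

lemma subst_mult: "subst \<phi> (f * g) = subst \<phi> f * subst \<phi> g"
proof -
  let ?s = "\<lambda>f m. Poly_Mapping.single m (Poly_Mapping.lookup f m)"
  have "subst \<phi> ((\<Sum>a\<in>Poly_Mapping.keys f. ?s f a) * (\<Sum>b\<in>Poly_Mapping.keys g. ?s g b)) =
      (\<Sum>a\<in>Poly_Mapping.keys f. \<Sum>b\<in>Poly_Mapping.keys g. subst \<phi> (?s f a) * subst \<phi> (?s g b))"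
    by (simp add: sum_product subst_sum mult_single monomial_value_add mult_ac)
  also have "\<dots> = subst \<phi> (\<Sum>a\<in>Poly_Mapping.keys f. ?s f a) * subst \<phi> (\<Sum>b\<in>Poly_Mapping.keys g. ?s g b)"
    by (simp only: sum_product subst_sum)
  finally show ?thesis by (simp only: poly_mapping_sum_single)
qed

lemma subst_power: "subst \<phi> (f ^ k) = subst \<phi> f ^ k"
  by (induction k) (simp_all add: subst_mult)

lemma subst_prod: "subst \<phi> (prod f A) = (\<Prod>a\<in>A. subst \<phi> (f a))"
  by (induction A rule: infinite_finite_induct) (simp_all add: subst_mult)

lemma subst_subst: "subst \<psi> (subst \<phi> f) = subst (\<lambda>v. subst \<psi> (\<phi> v)) f"
  unfolding subst_monomial_value[of \<phi>] subst_monomial_value[of "\<lambda>v. subst \<psi> (\<phi> v)"]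
  by (simp add: subst_sum subst_mult monomial_value_def subst_prod subst_power)

lemma subst_cong:
  assumes "f \<in> carrier (poly_ring V)" "\<And>v. v \<in> V \<Longrightarrow> \<phi> v = \<psi> v"
  shows "subst \<phi> f = subst \<psi> f"
proof -
  have "monomial_value \<phi> m = monomial_value \<psi> m" if "m \<in> Poly_Mapping.keys f" for m
    unfolding monomial_value_def
    by (rule prod.cong) (use assms that in \<open>force simp: poly_ring_def\<close>)+
  then show ?thesis by (simp add: subst_monomial_value)
qed

lemma monomial_value_var: "monomial_value var m = Poly_Mapping.single m 1"
proof -
  have var_power: "var v ^ k = Poly_Mapping.single (Poly_Mapping.single v k) 1" for v :: 'a and k
    by (induction k) (simp_all add: var_def mult_single flip: single_add)
  have "(\<Prod>v\<in>A. var v ^ Poly_Mapping.lookup m v) =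
      Poly_Mapping.single (\<Sum>v\<in>A. Poly_Mapping.single v (Poly_Mapping.lookup m v)) 1" for A
    by (induction A rule: infinite_finite_induct) (simp_all add: var_power mult_single)
  moreover have "(\<Sum>v\<in>Poly_Mapping.keys m. Poly_Mapping.single v (Poly_Mapping.lookup m v)) = m"
    by (rule poly_mapping_eqI) (simp add: lookup_sum lookup_single when_def in_keys_iff)
  ultimately show ?thesis by (simp add: monomial_value_def)
qed

text \<open>Setting the variables outside \<open>F\<close> to zero kills exactly the monomials that
  involve one of them and fixes all others. With \<open>F\<close> the initial segments of a
  permutation, this reads off coefficients from the restriction to one cone.\<close>

lemma lookup_subst_restrict:
  assumes "Poly_Mapping.keys m \<subseteq> F"
  shows "Poly_Mapping.lookup (subst (\<lambda>v. if v \<in> F then var v else 0) f) m = Poly_Mapping.lookup f m"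
proof -
  let ?\<phi> = "\<lambda>v. if v \<in> F then var v else 0"
  have val: "monomial_value ?\<phi> a = (if Poly_Mapping.keys a \<subseteq> F then Poly_Mapping.single a 1 else 0)" for a
  proof (cases "Poly_Mapping.keys a \<subseteq> F")
    case True
    then have "monomial_value ?\<phi> a = monomial_value var a"
      unfolding monomial_value_def by (intro prod.cong) auto
    then show ?thesis using True by (simp add: monomial_value_var)
  next
    case False
    then obtain v where "v \<in> Poly_Mapping.keys a" "v \<notin> F" by blast
    then have "(\<Prod>w\<in>Poly_Mapping.keys a. ?\<phi> w ^ Poly_Mapping.lookup a w) = 0"
      by (intro prod_zero) (auto simp: in_keys_iff zero_power intro!: bexI[of _ v])
    then show ?thesis using False by (simp add: monomial_value_def)
  qed
  have "of_int c * Poly_Mapping.single a 1 = Poly_Mapping.single a c" for a :: "'a \<Rightarrow>\<^sub>0 nat" and c :: int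
    by (simp add: of_int_poly_mapping mult_single)
  then have "subst ?\<phi> f = (\<Sum>a\<in>Poly_Mapping.keys f.
      if Poly_Mapping.keys a \<subseteq> F then Poly_Mapping.single a (Poly_Mapping.lookup f a) else 0)"
    unfolding subst_monomial_value val by (intro sum.cong) auto
  moreover have "Poly_Mapping.lookup (if Poly_Mapping.keys a \<subseteq> F
      then Poly_Mapping.single a (Poly_Mapping.lookup f a) else 0) m =
      (if a = m then Poly_Mapping.lookup f m else 0)" for a
    using assms by (simp add: lookup_single when_def)
  ultimately have "Poly_Mapping.lookup (subst ?\<phi> f) m =
      (\<Sum>a\<in>Poly_Mapping.keys f. if a = m then Poly_Mapping.lookup f m else 0)"
    by (simp only: lookup_sum)
  then show ?thesis by (simp add: in_keys_iff)
qed

section \<open>Piecewise polynomials determine the residue class\<close>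

lemma var_in_poly_ring: "v \<in> V \<Longrightarrow> var v \<in> carrier (poly_ring V)"
  by (simp add: poly_ring_def var_def)

lemma poly_ring_simps:
  "mult (poly_ring V) = (*)" "one (poly_ring V) = 1"
  "ring.zero (poly_ring V) = 0" "ring.add (poly_ring V) = (+)"
  by (simp_all add: poly_ring_def)

lemma poly_ring_mult: "f \<in> carrier (poly_ring V) \<Longrightarrow> g \<in> carrier (poly_ring V) \<Longrightarrow>
    f * g \<in> carrier (poly_ring V)"
  using monoid.m_closed[OF ring.is_monoid[OF cring.axioms(1)[OF cring_poly_ring[of V]]]]
  by (simp add: poly_ring_simps)

lemma poly_ring_add: "f \<in> carrier (poly_ring V) \<Longrightarrow> g \<in> carrier (poly_ring V) \<Longrightarrow>
    f + g \<in> carrier (poly_ring V)"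
  using ring.ring_simprules(1)[OF cring.axioms(1)[OF cring_poly_ring[of V]]]
  by (simp add: poly_ring_simps)

lemma poly_ring_const: "of_int c \<in> carrier (poly_ring V)"
  by (simp add: poly_ring_def flip: single_of_int)

lemma poly_ring_sum: "(\<And>a. a \<in> A \<Longrightarrow> f a \<in> carrier (poly_ring V)) \<Longrightarrow> sum f A \<in> carrier (poly_ring V)"
  by (induction A rule: infinite_finite_induct)
    (use poly_ring_const[of 0 V] in \<open>auto simp: poly_ring_add\<close>)

lemma poly_ring_prod: "(\<And>a. a \<in> A \<Longrightarrow> f a \<in> carrier (poly_ring V)) \<Longrightarrow> prod f A \<in> carrier (poly_ring V)"
  by (induction A rule: infinite_finite_induct)
    (use poly_ring_const[of 1 V] in \<open>auto simp: poly_ring_mult\<close>)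

lemma poly_ring_power: "f \<in> carrier (poly_ring V) \<Longrightarrow> f ^ k \<in> carrier (poly_ring V)"
  by (induction k) (use poly_ring_const[of 1 V] in \<open>auto simp: poly_ring_mult\<close>)

lemma poly_ring_uminus: "f \<in> carrier (poly_ring V) \<Longrightarrow> - f \<in> carrier (poly_ring V)"
  by (simp add: poly_ring_def)

lemma poly_ring_a_inv: "f \<in> carrier (poly_ring V) \<Longrightarrow> \<ominus>\<^bsub>poly_ring V\<^esub> f = - f"
  using ring.is_abelian_group[OF cring.axioms(1)[OF cring_poly_ring[of V]]]
  by (intro abelian_group.minus_equality) (auto simp: poly_ring_simps poly_ring_uminus)

lemma chow_ideal_ideal: "ideal (chow_ideal n) (x_ring n)"
  unfolding chow_ideal_def
  by (intro ring.genideal_ideal cring.axioms(1)[OF cring_poly_ring])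
    (auto intro!: poly_ring_mult poly_ring_sum var_in_poly_ring)

lemma chow_ideal_incomparable:
  assumes "S \<in> nonempty_subsets n" "T \<in> nonempty_subsets n" "\<not> S \<subseteq> T" "\<not> T \<subseteq> S"
  shows "var S * var T \<in> chow_ideal n"
  unfolding chow_ideal_def
  by (intro subsetD[OF ring.genideal_self[OF cring.axioms(1)[OF cring_poly_ring]]])
    (use assms in \<open>auto intro!: poly_ring_mult poly_ring_sum var_in_poly_ring\<close>)

lemma chow_ideal_mult:
  "a \<in> chow_ideal n \<Longrightarrow> f \<in> carrier (x_ring n) \<Longrightarrow> f * a \<in> chow_ideal n"
  using ideal.I_l_closed[OF chow_ideal_ideal] by (simp add: poly_ring_simps)

lemma chow_ideal_sum: "(\<And>a. a \<in> A \<Longrightarrow> f a \<in> chow_ideal n) \<Longrightarrow> sum f A \<in> chow_ideal n"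
proof (induction A rule: infinite_finite_induct)
  case (insert a A)
  then show ?case
    using additive_subgroup.a_closed[OF ideal.axioms(1)[OF chow_ideal_ideal[of n]]]
    by (simp add: poly_ring_simps)
qed (use additive_subgroup.zero_closed[OF ideal.axioms(1)[OF chow_ideal_ideal[of n]]]
  in \<open>simp_all add: poly_ring_simps\<close>)

lemma chow_residue_eqI:
  assumes "f \<in> carrier (x_ring n)" "g \<in> carrier (x_ring n)" "f - g \<in> chow_ideal n"
  shows "chow_residue n f = chow_residue n g"
proof -
  have "f \<ominus>\<^bsub>x_ring n\<^esub> g = f - g"
    using assms by (simp add: a_minus_def poly_ring_a_inv poly_ring_simps)
  then show ?thesis unfolding chow_residue_def
    using ring.quotient_eq_iff_same_a_r_cos[OF cring.axioms(1)[OF cring_poly_ring]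
      chow_ideal_ideal assms(1,2)] assms(3) by simp
qed

text \<open>The monomial is a multiple of the generator \<open>var S * var T\<close>.\<close>

lemma single_add_in_chow_ideal:
  assumes "Poly_Mapping.keys m \<subseteq> nonempty_subsets n"
    and "S \<in> Poly_Mapping.keys m" "T \<in> Poly_Mapping.keys m" "\<not> S \<subseteq> T" "\<not> T \<subseteq> S"
  shows "Poly_Mapping.single m c \<in> chow_ideal n"
proof -
  let ?d = "Poly_Mapping.single S 1 + Poly_Mapping.single T (1::nat)"
  let ?m = "m - ?d"
  have pos: "0 < Poly_Mapping.lookup m S" "0 < Poly_Mapping.lookup m T" and "S \<noteq> T"
    using assms by (auto simp: in_keys_iff)
  \<comment> \<open>Subtraction of exponents is truncated. It loses nothing here: since
    \<open>S \<noteq> T\<close>, each of the two positive exponents is lowered only by 1.\<close>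
  then have m: "m = ?m + ?d"
    by (intro poly_mapping_eqI) (auto simp: lookup_add lookup_minus lookup_single when_def)
  have "Poly_Mapping.keys ?m \<subseteq> Poly_Mapping.keys m"
    by (auto simp: in_keys_iff lookup_minus)
  then have "Poly_Mapping.single ?m c \<in> carrier (x_ring n)"
    using assms(1) by (auto simp: poly_ring_def split: if_splits)
  then have "Poly_Mapping.single ?m c * (var S * var T) \<in> chow_ideal n"
    using assms by (intro chow_ideal_mult chow_ideal_incomparable) auto
  also have "Poly_Mapping.single ?m c * (var S * var T) = Poly_Mapping.single (?m + ?d) c"
    unfolding var_def mult_single by simp
  finally show ?thesis using m by simp
qed

section \<open>Every chain of subsets lies in a complete flag\<close>

text \<open>Induction on the size of \<open>A\<close>. The members other than \<open>A\<close> have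
  a greatest one, which is a proper subset, so some \<open>a\<close> lies in none of them. This
  \<open>a\<close> is numbered last, and the rest is a chain in \<open>A - {a}\<close>.\<close>

lemma chain_initial_segments:
  assumes "finite A" "\<And>S. S \<in> C \<Longrightarrow> S \<subseteq> A" "\<And>S T. S \<in> C \<Longrightarrow> T \<in> C \<Longrightarrow> S \<subseteq> T \<or> T \<subseteq> S"
  shows "\<exists>f. bij_betw f {1..card A} A \<and> (\<forall>S\<in>C. S = f ` {1..card S})"
  using assms
proof (induction "card A" arbitrary: A C)
  case 0
  then have "A = {}" by simp
  moreover have "S = {}" if "S \<in> C" for S using 0(3)[OF that] \<open>A = {}\<close> by blast
  ultimately have "\<forall>S\<in>C. S = f ` {1..card S}" for f :: "nat \<Rightarrow> 'a" by fastforce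
  then show ?case using \<open>A = {}\<close> by (simp add: bij_betw_def)
next
  case (Suc m)
  let ?C = "C - {A}"
  have "finite ?C" using Suc.prems(1,2) by (intro finite_subset[of ?C "Pow A"]) auto
  have "\<exists>a\<in>A. \<forall>S\<in>?C. a \<notin> S"
  proof (cases "?C = {}")
    case True
    have "A \<noteq> {}" using Suc.hyps(2) by auto
    then show ?thesis using True by blast
  next
    case False
    then obtain M where M: "M \<in> ?C" "\<forall>S\<in>?C. M \<subseteq> S \<longrightarrow> M = S"
      using finite_has_maximal[OF \<open>finite ?C\<close>] by blast
    \<comment> \<open>Since members of \<open>C\<close> are pairwise comparable, a maximal one is
      greatest.\<close>
    have "S \<subseteq> M" if "S \<in> ?C" for S
      using M Suc.prems(3)[of S M] that by blast
    moreover have "M \<subset> A" using M(1) Suc.prems(2)[of M] by blast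
    ultimately show ?thesis by blast
  qed
  then obtain a where a: "a \<in> A" "\<forall>S\<in>?C. a \<notin> S" by blast
  have m: "m = card (A - {a})" using Suc.hyps(2) a(1) Suc.prems(1) by simp
  obtain f where f: "bij_betw f {1..m} (A - {a})" "\<forall>S\<in>?C. S = f ` {1..card S}"
    using Suc.hyps(1)[OF m, of ?C] Suc.prems a(2) unfolding m by blast
  \<comment> \<open>Only the last value is new, so segments with at most \<open>m\<close> elements
    are the same for \<open>f\<close> and \<open>?g\<close>.\<close>
  let ?g = "f(Suc m := a)"
  have "bij_betw ?g {1..m} (A - {a})" 
    by (subst bij_betw_cong[where g = f]) (use f(1) in auto)
  then have "bij_betw ?g (insert (Suc m) {1..m}) (insert (?g (Suc m)) (A - {a}))"
    using notIn_Un_bij_betw[of "Suc m" "{1..m}" ?g "A - {a}"] by simp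
  moreover have "insert (Suc m) {1..m} = {1..Suc m}" "insert (?g (Suc m)) (A - {a}) = A"
    using a(1) by auto
  ultimately have g: "bij_betw ?g {1..Suc m} A" by simp
  have "S = ?g ` {1..card S}" if S: "S \<in> C" for S
  proof (cases "S = A")
    case True
    then show ?thesis using g Suc.hyps(2) by (simp add: bij_betw_def)
  next
    case False
    then have "S \<subseteq> A - {a}" using S a(2) Suc.prems(2) by blast
    then have "card S \<le> m" unfolding m using Suc.prems(1) by (intro card_mono) auto
    then have "f ` {1..card S} = ?g ` {1..card S}" by (intro image_cong) auto
    moreover have "S = f ` {1..card S}" using f(2) S False by blast
    ultimately show ?thesis by (rule trans[rotated])
  qed
  then show ?case using g unfolding Suc.hyps(2)[symmetric]
    by (intro exI[of _ ?g] conjI ballI)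
qed

text \<open>Geometrically, the sets of a chain are rays of a common maximal cone, the cone of
  \<open>\<sigma>\<close>.\<close>

lemma chain_in_flag:
  assumes "C \<subseteq> nonempty_subsets n" "\<And>S T. S \<in> C \<Longrightarrow> T \<in> C \<Longrightarrow> S \<subseteq> T \<or> T \<subseteq> S"
  shows "\<exists>\<sigma>. \<sigma> permutes {1..n} \<and> (\<forall>S\<in>C. S = \<sigma> ` {1..card S})"
proof -
  obtain f where f: "bij_betw f {1..n} {1..n}" "\<forall>S\<in>C. S = f ` {1..card S}"
    using chain_initial_segments[of "{1..n}" C] assms by (auto simp: nonempty_subsets_def)
  \<comment> \<open>\<open>permutes\<close> demands the identity outside \<open>{1..n}\<close>,
    whereas \<open>f\<close> is arbitrary there.\<close>
  let ?\<sigma> = "\<lambda>i. if i \<in> {1..n} then f i else i"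
  have "bij_betw ?\<sigma> {1..n} {1..n}"
    using f(1) bij_betw_cong[of "{1..n}" ?\<sigma> f "{1..n}"] by simp
  then have "?\<sigma> permutes {1..n}" by (rule bij_imp_permutes) (rule if_not_P)
  moreover have "S = ?\<sigma> ` {1..card S}" if "S \<in> C" for S
  proof -
    have "card S \<le> card {1..n}" using assms(1) that
      by (intro card_mono) (auto simp: nonempty_subsets_def)
    then have "f ` {1..card S} = ?\<sigma> ` {1..card S}" by (intro image_cong) auto
    moreover have "S = f ` {1..card S}" using f(2) that by blast
    ultimately show ?thesis by (rule trans[rotated])
  qed
  ultimately show ?thesis by (intro exI[of _ ?\<sigma>] conjI ballI)
qed

lemma card_flag:
  assumes "\<sigma> permutes {1..n}" shows "card (\<sigma> ` {1..i}) = i"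
  using card_image[OF inj_on_subset[OF permutes_inj[OF assms]], of "{1..i}"] by simp

text \<open>In the coordinates \<open>x\<^sub>S\<close>, \<open>S\<close> an initial segment of \<open>\<sigma>\<close>, the coordinate \<open>t\<^sub>e\<close> is
  \<open>\<Sum>\<^bsub>S \<ni> e\<^esub> x\<^sub>S\<close>, which inverts the restriction to the cone of \<open>\<sigma>\<close>.\<close>

lemma subst_courant_left_inverse:
  assumes p: "\<sigma> permutes {1..n}" and S: "S \<in> nonempty_subsets n"
  shows "subst (\<lambda>e. \<Sum>i\<in>{Hilbert_Choice.inv \<sigma> e..n}. var (\<sigma> ` {1..i})) (courant n S \<sigma>) =
    (if S \<in> {S. S = \<sigma> ` {1..card S}} then var S else 0)"
proof (cases "S = \<sigma> ` {1..card S}")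
  case True
  let ?\<psi> = "\<lambda>e. \<Sum>i\<in>{Hilbert_Choice.inv \<sigma> e..n}. var (\<sigma> ` {1..i})"
  let ?i = "card S"
  have "?i \<le> card {1..n}" using S
    by (intro card_mono) (auto simp: nonempty_subsets_def)
  then have le: "?i \<le> n" by simp
  have c: "courant n S \<sigma> = var (\<sigma> ?i) - (if ?i < n then var (\<sigma> (Suc ?i)) else 0)"
    using True by (simp add: courant_def)
  \<comment> \<open>The images of the two coordinates are tail sums that differ only in the term at
    \<open>?i\<close>. For \<open>?i = n\<close> the second tail is empty, in agreement with the
    missing coordinate.\<close>
  have "{?i..n} = insert ?i {Suc ?i..n}" using le by auto
  then have "subst ?\<psi> (courant n S \<sigma>) = var (\<sigma> ` {1..?i})"
    using le unfolding c by (simp add: subst_diff permutes_inverses[OF p])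
  then show ?thesis using True by simp
qed (simp add: courant_def)

text \<open>The difference is put into the ideal monomial by monomial. If the sets in a monomial
  formed a chain, its coefficient would be visible on a cone whose flag contains the chain, hence
  zero. So two of them are incomparable.\<close>

lemma chow_residue_unique:
  assumes f: "f \<in> carrier (x_ring n)" and g: "g \<in> carrier (x_ring n)"
    and eq: "\<And>\<sigma>. \<sigma> permutes {1..n} \<Longrightarrow>
      subst (\<lambda>S. courant n S \<sigma>) f = subst (\<lambda>S. courant n S \<sigma>) g"
  shows "chow_residue n f = chow_residue n g"
proof (rule chow_residue_eqI[OF f g])
  let ?h = "f - g"
  have h: "?h \<in> carrier (x_ring n)"
    using poly_ring_add[OF f poly_ring_uminus[OF g]] by simp
  have "Poly_Mapping.single m (Poly_Mapping.lookup ?h m) \<in> chow_ideal n"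
    if m: "m \<in> Poly_Mapping.keys ?h" for m
  proof -
    have keys: "Poly_Mapping.keys m \<subseteq> nonempty_subsets n"
      using h m by (auto simp: poly_ring_def)
    have "\<not> (\<forall>S\<in>Poly_Mapping.keys m. \<forall>T\<in>Poly_Mapping.keys m. S \<subseteq> T \<or> T \<subseteq> S)"
    proof
      assume "\<forall>S\<in>Poly_Mapping.keys m. \<forall>T\<in>Poly_Mapping.keys m. S \<subseteq> T \<or> T \<subseteq> S"
      then obtain \<sigma> where \<sigma>: "\<sigma> permutes {1..n}"
        "\<forall>S\<in>Poly_Mapping.keys m. S = \<sigma> ` {1..card S}"
        using chain_in_flag[OF keys] by blast
      let ?F = "{S. S = \<sigma> ` {1..card S}}"
      let ?\<psi> = "\<lambda>e. \<Sum>i\<in>{Hilbert_Choice.inv \<sigma> e..n}. var (\<sigma> ` {1..i})"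
      \<comment> \<open>Restricting to the cone and then inverting the change of coordinates is the
        projection that discards the variables outside the flag.\<close>
      have "subst (\<lambda>S. if S \<in> ?F then var S else 0) ?h =
          subst (\<lambda>S. subst ?\<psi> (courant n S \<sigma>)) ?h"
        by (rule subst_cong[OF h]) (rule subst_courant_left_inverse[OF \<sigma>(1), symmetric])
      also have "\<dots> = subst ?\<psi> (subst (\<lambda>S. courant n S \<sigma>) ?h)" by (simp add: subst_subst)
      also have "\<dots> = 0" using eq[OF \<sigma>(1)] by (simp add: subst_diff)
      finally have "Poly_Mapping.lookup ?h m = 0"
        using lookup_subst_restrict[of m ?F ?h] \<sigma>(2) by auto
      then show False using m by (simp add: in_keys_iff)
    qed
    then show ?thesis using single_add_in_chow_ideal[OF keys] by blast
  qed
  then have "(\<Sum>m\<in>Poly_Mapping.keys ?h. Poly_Mapping.single m (Poly_Mapping.lookup ?h m)) \<in> chow_ideal n"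
    by (rule chow_ideal_sum)
  then show "?h \<in> chow_ideal n" by (simp only: poly_mapping_sum_single)
qed

text \<open>Reduces the definite description to exhibiting one lift; its uniqueness part is
  \<open>chow_residue_unique\<close>.\<close>

lemma nonequivariant_eqI:
  assumes f: "f \<in> carrier (x_ring n)"
    and eq: "\<And>\<sigma>. \<sigma> permutes {1..n} \<Longrightarrow> subst (\<lambda>S. courant n S \<sigma>) f = g \<sigma>"
  shows "nonequivariant n g = chow_residue n f"
  unfolding nonequivariant_def
proof (rule the_equality)
  interpret ideal "chow_ideal n" "x_ring n" by (rule chow_ideal_ideal)
  have "chow_residue n f \<in> carrier (chow_ring n)"
    using ring_hom_closed[OF rcos_ring_hom f] by (simp add: chow_residue_def chow_ring_def)
  then show "chow_residue n f \<in> carrier (chow_ring n) \<and>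
      (\<exists>h\<in>carrier (x_ring n). chow_residue n f = chow_residue n h \<and>
         (\<forall>\<sigma>. \<sigma> permutes {1..n} \<longrightarrow> subst (\<lambda>S. courant n S \<sigma>) h = g \<sigma>))"
    using f eq by blast
  show "c = chow_residue n f"
    if c: "c \<in> carrier (chow_ring n) \<and>
      (\<exists>h\<in>carrier (x_ring n). c = chow_residue n h \<and>
         (\<forall>\<sigma>. \<sigma> permutes {1..n} \<longrightarrow> subst (\<lambda>S. courant n S \<sigma>) h = g \<sigma>))" for c
  proof -
    obtain h where h: "h \<in> carrier (x_ring n)" "c = chow_residue n h"
      "\<And>\<sigma>. \<sigma> permutes {1..n} \<Longrightarrow> subst (\<lambda>S. courant n S \<sigma>) h = g \<sigma>"
      using c by blast
    show ?thesis unfolding h(2) by (rule chow_residue_unique[OF h(1) f]) (simp add: h(3) eq)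
  qed
qed

section \<open>Elementary symmetric functions and sums over chains\<close>

text \<open>The elementary symmetric polynomials, defined through their generating function because
  \<open>equivariant_chern\<close> is also a coefficient of such a product.\<close>

definition esym :: "'b set \<Rightarrow> ('b \<Rightarrow> 'a::comm_ring_1) \<Rightarrow> nat \<Rightarrow> 'a" where
  "esym A u k = fps_nth (\<Prod>i\<in>A. 1 + fps_const (u i) * fps_X) k"

lemma esym_0 [simp]: "esym A u 0 = 1"
  by (induction A rule: infinite_finite_induct) (simp_all add: esym_def fps_mult_nth_0)

lemma esym_empty: "esym {} u k = (if k = 0 then 1 else 0)"
  by (simp add: esym_def)

lemma esym_insert:
  assumes "finite A" "a \<notin> A"
  shows "esym (insert a A) u (Suc k) = esym A u (Suc k) + u a * esym A u k"
proof -
  have "(1 + fps_const c * fps_X) * P = P + fps_X * (fps_const c * P)" for c and P :: "'b fps"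
    by (simp add: algebra_simps)
  then show ?thesis using assms by (simp add: esym_def)
qed

text \<open>Disposes of the summands of the shift formula in which the truncated
  \<open>card A - j\<close> would break Pascal's rule.\<close>

lemma esym_eq_0: "finite A \<Longrightarrow> card A < k \<Longrightarrow> esym A u k = 0"
proof (induction A arbitrary: k rule: finite_induct)
  case empty
  then show ?case by (simp add: esym_empty)
next
  case (insert a A)
  then obtain l where "k = Suc l" by (cases k) auto
  then show ?case using insert by (simp add: esym_insert)
qed

text \<open>Expand each product of \<open>k\<close> factors \<open>u i + c\<close>. A fixed set of
  \<open>j\<close> indices that contribute \<open>u\<close> extends to \<open>k\<close> indices in
  \<open>(card A - j) choose (k - j)\<close> ways, each new index contributing \<open>c\<close>. The
  formal proof is an induction on \<open>A\<close> with Pascal's rule.\<close>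

lemma esym_shift:
  assumes "finite A"
  shows "esym A (\<lambda>i. u i + c) k =
    (\<Sum>j\<le>k. c ^ (k - j) * of_nat ((card A - j) choose (k - j)) * esym A u j)"
  using assms
proof (induction A arbitrary: k rule: finite_induct)
  case empty
  have "(\<Sum>j\<le>k. c ^ (k - j) * of_nat ((card {} - j) choose (k - j)) * esym {} u j) =
      (\<Sum>j\<le>k. if j = 0 then c ^ k * of_nat (0 choose k) else 0)"
    by (intro sum.cong) (auto simp: esym_empty)
  then show ?case by (cases k) (auto simp: esym_empty)
next
  case (insert a A)
  let ?N = "card A"
  let ?e = "esym A u"
  let ?b = "\<lambda>m k j. c ^ (k - j) * of_nat ((m - j) choose (k - j))"
  show ?case
  proof (cases k)
    case 0
    then show ?thesis by simp
  next
    case (Suc l)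
    have pascal: "?b (Suc ?N) (Suc l) j * ?e j = (?b ?N (Suc l) j + c * ?b ?N l j) * ?e j"
      if "j \<le> l" for j
    proof (cases "j \<le> ?N")
      case True
      then show ?thesis using that by (simp add: Suc_diff_le algebra_simps)
    next
      case False
      then have "?e j = 0" using insert.hyps(1) by (intro esym_eq_0) auto
      then show ?thesis by simp
    qed
    \<comment> \<open>The recursion for \<open>insert a A\<close> applies from degree one on.
      Lowering all three indices by one turns \<open>?b (Suc ?N) (Suc l) (Suc j)\<close> into
      \<open>?b ?N l j\<close>.\<close>
    have "(\<Sum>j\<le>Suc l. ?b (Suc ?N) (Suc l) j * esym (insert a A) u j) =
        ?b (Suc ?N) (Suc l) 0 + (\<Sum>j\<le>l. ?b ?N l j * (?e (Suc j) + u a * ?e j))"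
      unfolding sum.atMost_Suc_shift using insert.hyps by (simp add: esym_insert)
    also have "\<dots> = (?b (Suc ?N) (Suc l) 0 + (\<Sum>j\<le>l. ?b ?N l j * ?e (Suc j))) +
        u a * (\<Sum>j\<le>l. ?b ?N l j * ?e j)"
      by (simp add: algebra_simps sum.distrib sum_distrib_left)
    also have "?b (Suc ?N) (Suc l) 0 + (\<Sum>j\<le>l. ?b ?N l j * ?e (Suc j)) =
        (\<Sum>j\<le>Suc l. ?b (Suc ?N) (Suc l) j * ?e j)"
      unfolding sum.atMost_Suc_shift by simp
    also have "\<dots> = (\<Sum>j\<le>l. (?b ?N (Suc l) j + c * ?b ?N l j) * ?e j) + ?e (Suc l)"
      unfolding sum.atMost_Suc
      by (intro arg_cong2[where f = "(+)"] sum.cong refl) (simp_all only: pascal atMost_iff, simp)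
    also have "\<dots> = (\<Sum>j\<le>Suc l. ?b ?N (Suc l) j * ?e j) + c * (\<Sum>j\<le>l. ?b ?N l j * ?e j)"
      unfolding sum.atMost_Suc by (simp add: algebra_simps sum.distrib sum_distrib_left)
    finally have rhs: "(\<Sum>j\<le>Suc l. ?b (Suc ?N) (Suc l) j * esym (insert a A) u j) =
        (\<Sum>j\<le>Suc l. ?b ?N (Suc l) j * ?e j) + c * (\<Sum>j\<le>l. ?b ?N l j * ?e j) +
        u a * (\<Sum>j\<le>l. ?b ?N l j * ?e j)" .
    have "esym (insert a A) (\<lambda>i. u i + c) (Suc l) =
        (\<Sum>j\<le>Suc l. ?b ?N (Suc l) j * ?e j) + (u a + c) * (\<Sum>j\<le>l. ?b ?N l j * ?e j)"
      by (simp only: esym_insert[OF insert.hyps] insert.IH)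
    then show ?thesis
      unfolding Suc card_insert_disjoint[OF insert.hyps] rhs by (simp only: distrib_right ac_simps)
  qed
qed

section \<open>Sums over chains with exponents\<close>

text \<open>Generalizes \<open>exponent_chains\<close> to an arbitrary family \<open>V\<close>, so
  that a flag can be built up one set at a time.\<close>

definition weighted_chains :: "nat set set \<Rightarrow> nat \<Rightarrow> (nat set list \<times> nat list) set" where
  "weighted_chains V k = {(Ss, ps).
     set Ss \<subseteq> V \<and> sorted_wrt (\<subset>) Ss \<and>
     length ps = length Ss \<and> (\<forall>p\<in>set ps. 0 < p) \<and> sum_list ps = k}"

definition chain_sum :: "(nat set \<Rightarrow> nat) \<Rightarrow> (nat set \<Rightarrow> 'a::comm_ring_1) \<Rightarrow> nat set set \<Rightarrow> nat \<Rightarrow> 'a" where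
  "chain_sum \<rho> y V k = (\<Sum>(Ss, ps)\<in>weighted_chains V k.
     of_int (alpha \<rho> Ss ps) * (\<Prod>i<length Ss. y (Ss ! i) ^ (ps ! i)))"

text \<open>Positive exponents with sum \<open>k\<close> bound both the length of the chain and each
  exponent by \<open>k\<close>.\<close>

lemma finite_weighted_chains:
  assumes "finite V" shows "finite (weighted_chains V k)"
proof (rule finite_subset)
  have len: "length ps \<le> sum_list ps" if "\<forall>p\<in>set ps. 0 < p" for ps :: "nat list"
    using that by (induction ps) auto
  show "weighted_chains V k \<subseteq>
      {Ss. set Ss \<subseteq> V \<and> length Ss \<le> k} \<times> {ps. set ps \<subseteq> {..k} \<and> length ps \<le> k}"
    using len member_le_sum_list by (fastforce simp: weighted_chains_def)
  show "finite ({Ss. set Ss \<subseteq> V \<and> length Ss \<le> k} \<times> {ps. set ps \<subseteq> {..k} \<and> length ps \<le> k})"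
    using assms by (intro finite_cartesian_product finite_lists_length_le) auto
qed

text \<open>As \<open>S\<close> contains all other sets strictly, a chain through \<open>S\<close>
  must end in it. Here \<open>j\<close> is the total exponent of what remains after \<open>S\<close>
  is removed, and \<open>j < k\<close> because the exponent of \<open>S\<close> is positive.\<close>

lemma weighted_chains_insert:
  assumes top: "\<And>T. T \<in> V \<Longrightarrow> T \<subset> S"
  shows "weighted_chains (insert S V) k = weighted_chains V k \<union>
    (\<Union>j\<in>{..<k}. (\<lambda>(Ss, ps). (Ss @ [S], ps @ [k - j])) ` weighted_chains V j)" (is "?L = ?R")
proof
  show "?R \<subseteq> ?L"
  proof -
    have "\<forall>T\<in>V. T \<subseteq> S \<and> T \<noteq> S" using top by blast
    then show ?thesis by (auto simp: weighted_chains_def sorted_wrt_append) blast+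
  qed
  show "?L \<subseteq> ?R"
  proof (rule subrelI)
    fix Ss ps assume c: "(Ss, ps) \<in> ?L"
    show "(Ss, ps) \<in> ?R"
    proof (cases "S \<in> set Ss")
      case False
      then show ?thesis using c by (auto simp: weighted_chains_def)
    next
      case True
      obtain Ts T where Ss: "Ss = Ts @ [T]" using True by (cases Ss rule: rev_cases) auto
      obtain qs q where ps: "ps = qs @ [q]"
        using c Ss by (cases ps rule: rev_cases) (auto simp: weighted_chains_def)
      have below: "\<forall>U\<in>set Ts. U \<subset> T" and sub: "set Ts \<subseteq> insert S V" "T \<in> insert S V"
        using c Ss by (auto simp: weighted_chains_def sorted_wrt_append)
      have "T = S"
      proof (rule ccontr)
        assume "T \<noteq> S"
        then have "T \<subset> S" "S \<subset> T" using top sub(2) True below Ss by auto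
        then show False by blast
      qed
      then have "set Ts \<subseteq> V" using sub(1) below by blast
      then have "(Ts, qs) \<in> weighted_chains V (k - q)" "q \<le> k" "0 < q"
        using c Ss ps by (auto simp: weighted_chains_def sorted_wrt_append)
      then show ?thesis using Ss ps \<open>T = S\<close>
        by (intro UnI2 UN_I[of "k - q"] image_eqI[of _ _ "(Ts, qs)"]) auto
    qed
  qed
qed

text \<open>The last binomial coefficient of \<open>alpha\<close> depends on the earlier exponents
  only through their sum \<open>j\<close>, so it factors out of the sum over shorter chains. The
  term \<open>j = k\<close>, with coefficient 1, accounts for the chains that avoid
  \<open>S\<close>.\<close>

lemma chain_sum_insert:
  fixes y :: "nat set \<Rightarrow> 'a::comm_ring_1"
  assumes "finite V" and top: "\<And>T. T \<in> V \<Longrightarrow> T \<subset> S"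
  shows "chain_sum \<rho> y (insert S V) k =
    (\<Sum>j\<le>k. (- y S) ^ (k - j) * of_nat ((\<rho> S - j) choose (k - j)) * chain_sum \<rho> y V j)"
proof -
  let ?g = "\<lambda>(Ss, ps). of_int (alpha \<rho> Ss ps) * (\<Prod>i<length Ss. y (Ss ! i) ^ (ps ! i)) :: 'a"
  let ?ext = "\<lambda>j (Ss, ps). (Ss @ [S], ps @ [k - j])"
  let ?b = "\<lambda>j. (- y S) ^ (k - j) * of_nat ((\<rho> S - j) choose (k - j))"
  have fin: "finite (weighted_chains V j)" for j by (rule finite_weighted_chains[OF assms(1)])
  have ext: "?g (?ext j c) = ?b j * ?g c" if "c \<in> weighted_chains V j" for j c
  proof -
    obtain Ss ps where c: "c = (Ss, ps)" by force
    have l: "length ps = length Ss" and s: "sum_list ps = j"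
      using that c by (auto simp: weighted_chains_def)
    have "alpha \<rho> (Ss @ [S]) (ps @ [k - j]) =
        (-1) ^ (k - j) * int ((\<rho> S - j) choose (k - j)) * alpha \<rho> Ss ps"
      using l s by (simp add: alpha_def nth_append power_add)
    moreover have "(\<Prod>i<length (Ss @ [S]). y ((Ss @ [S]) ! i) ^ ((ps @ [k - j]) ! i)) =
        y S ^ (k - j) * (\<Prod>i<length Ss. y (Ss ! i) ^ (ps ! i))"
      using l by (simp add: nth_append)
    ultimately show ?thesis unfolding c by (simp add: power_minus[of "y S"] mult_ac)
  qed
  have chains: "weighted_chains (insert S V) k =
      weighted_chains V k \<union> (\<Union>j\<in>{..<k}. ?ext j ` weighted_chains V j)"
    by (rule weighted_chains_insert) (rule top)
  have "S \<notin> V" using top by blast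
  then have disj: "weighted_chains V k \<inter> (\<Union>j\<in>{..<k}. ?ext j ` weighted_chains V j) = {}"
    by (auto simp: weighted_chains_def)
  have inj: "inj_on (?ext j) (weighted_chains V j)" for j
    by (auto simp: inj_on_def)
  have "chain_sum \<rho> y (insert S V) k = sum ?g (weighted_chains V k) +
      sum ?g (\<Union>j\<in>{..<k}. ?ext j ` weighted_chains V j)"
    unfolding chain_sum_def chains
    by (rule sum.union_disjoint) (use fin disj in auto)
  also have "sum ?g (\<Union>j\<in>{..<k}. ?ext j ` weighted_chains V j) =
      (\<Sum>j<k. sum ?g (?ext j ` weighted_chains V j))"
    by (rule sum.UNION_disjoint) (use fin in auto)
  also have "\<dots> = (\<Sum>j<k. ?b j * chain_sum \<rho> y V j)"
  proof (rule sum.cong[OF refl])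
    fix j
    have "sum ?g (?ext j ` weighted_chains V j) = (\<Sum>c\<in>weighted_chains V j. ?g (?ext j c))"
      unfolding sum.reindex[OF inj] o_def ..
    also have "\<dots> = (\<Sum>c\<in>weighted_chains V j. ?b j * ?g c)" by (rule sum.cong[OF refl ext])
    finally show "sum ?g (?ext j ` weighted_chains V j) = ?b j * chain_sum \<rho> y V j"
      by (simp add: chain_sum_def sum_distrib_left)
  qed
  also have "sum ?g (weighted_chains V k) = ?b k * chain_sum \<rho> y V k"
    by (simp add: chain_sum_def)
  finally show ?thesis by (simp add: lessThan_Suc_atMost[symmetric])
qed

text \<open>A set outside \<open>W\<close> occurs with positive exponent, so its value 0 makes the
  whole term vanish.\<close>

lemma chain_sum_mono_neutral:
  assumes "finite V" "W \<subseteq> V" "\<And>T. T \<in> V - W \<Longrightarrow> y T = 0"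
  shows "chain_sum \<rho> y V k = chain_sum \<rho> y W k"
  unfolding chain_sum_def
proof (rule sum.mono_neutral_right[OF finite_weighted_chains[OF assms(1)]])
  show "weighted_chains W k \<subseteq> weighted_chains V k"
    using assms(2) by (auto simp: weighted_chains_def)
  show "\<forall>c\<in>weighted_chains V k - weighted_chains W k.
      (case c of (Ss, ps) \<Rightarrow> of_int (alpha \<rho> Ss ps) * (\<Prod>i<length Ss. y (Ss ! i) ^ (ps ! i))) = 0"
  proof (clarify)
    fix Ss ps assume c: "(Ss, ps) \<in> weighted_chains V k" "(Ss, ps) \<notin> weighted_chains W k"
    then obtain T where "T \<in> set Ss" "T \<notin> W" by (auto simp: weighted_chains_def)
    then obtain i where i: "i < length Ss" "Ss ! i \<notin> W" by (auto simp: in_set_conv_nth)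
    then have "y (Ss ! i) = 0" "0 < ps ! i"
      using c(1) assms(3) by (auto simp: weighted_chains_def subset_iff)
    then have "(\<Prod>i<length Ss. y (Ss ! i) ^ (ps ! i)) = 0"
      using i(1) by (intro prod_zero) (auto intro!: bexI[of _ i] simp: zero_power)
    then show "of_int (alpha \<rho> Ss ps) * (\<Prod>i<length Ss. y (Ss ! i) ^ (ps ! i)) = 0" by simp
  qed
qed

text \<open>\<open>J\<close> consists of the positions at which \<open>\<rho>\<close> jumps along
  the flag. Adding the set \<open>F (Suc m)\<close> lengthens every tail sum by the same term, so
  \<open>chain_sum_insert\<close> and \<open>esym_shift\<close> give identical recursions.\<close>

lemma chain_sum_flag:
  fixes F :: "nat \<Rightarrow> nat set" and y :: "nat set \<Rightarrow> 'a::comm_ring_1"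
  assumes F: "\<And>i j. 1 \<le> i \<Longrightarrow> i < j \<Longrightarrow> j \<le> n \<Longrightarrow> F i \<subset> F j"
    and \<rho>: "\<And>i. 1 \<le> i \<Longrightarrow> i \<le> n \<Longrightarrow> \<rho> (F i) = card (J \<inter> {1..i})"
    and "m \<le> n"
  shows "chain_sum \<rho> y (F ` {1..m}) k = esym (J \<inter> {1..m}) (\<lambda>j. - (\<Sum>i=j..m. y (F i))) k"
  using \<open>m \<le> n\<close>
proof (induction m arbitrary: k)
  case 0
  have "weighted_chains {} k = (if k = 0 then {([], [])} else {})"
    by (auto simp: weighted_chains_def)
  then show ?case by (simp add: chain_sum_def esym_empty alpha_def)
next
  case (Suc m)
  let ?S = "F (Suc m)"
  let ?u = "\<lambda>m j. - (\<Sum>i=j..m. y (F i))"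
  have img: "F ` {1..Suc m} = insert ?S (F ` {1..m})" by (simp add: atLeastAtMostSuc_conv)
  \<comment> \<open>At index \<open>Suc m\<close> the tail sum up to \<open>m\<close> is empty, so
    this variable is 0. Admitting it before the shift makes the cardinality in
    \<open>esym_shift\<close> equal to \<open>\<rho> ?S\<close>.\<close>
  have same: "esym (J \<inter> {1..Suc m}) (?u m) j = esym (J \<inter> {1..m}) (?u m) j" for j
    unfolding esym_def
    by (intro arg_cong2[where f = fps_nth] prod.mono_neutral_right)
      (auto simp: atLeastAtMostSuc_conv)
  have "chain_sum \<rho> y (F ` {1..Suc m}) k = (\<Sum>j\<le>k. (- y ?S) ^ (k - j) *
      of_nat ((card (J \<inter> {1..Suc m}) - j) choose (k - j)) * chain_sum \<rho> y (F ` {1..m}) j)"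
    unfolding img
  proof (subst chain_sum_insert)
    show "T \<subset> ?S" if "T \<in> F ` {1..m}" for T
      using that F[OF _ _ Suc.prems] by fastforce
  qed (use Suc.prems in \<open>simp_all add: \<rho>\<close>)
  also have "\<dots> = esym (J \<inter> {1..Suc m}) (\<lambda>j. ?u m j + - y ?S) k"
    by (subst esym_shift) (use Suc in \<open>simp_all add: same del: One_nat_def\<close>)
  also have "\<dots> = esym (J \<inter> {1..Suc m}) (?u (Suc m)) k"
    unfolding esym_def
    by (intro arg_cong2[where f = fps_nth] prod.cong) (auto simp: algebra_simps)
  finally show ?case .
qed

section \<open>Chern classes of sums of characters\<close>

text \<open>The characters are pairwise distinct, so each has multiplicity one and contributes a
  linear factor with weight \<open>- var i\<close>.\<close>

lemma equivariant_chern_character_sum: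
  assumes fin: "finite A" and \<kappa>: "\<kappa> \<sigma> = (\<Sum>i\<in>A. character i (-1))"
  shows "equivariant_chern k \<kappa> \<sigma> = esym A (\<lambda>i. - var i) k"
proof -
  let ?m = "\<lambda>i. Poly_Mapping.single i (-1) :: nat \<Rightarrow>\<^sub>0 int"
  have inj: "inj_on ?m A" by (auto simp: inj_on_def dest!: arg_cong[of _ _ Poly_Mapping.keys])
  have lookup: "Poly_Mapping.lookup (\<kappa> \<sigma>) m = (if m \<in> ?m ` A then 1 else 0)" for m
  proof -
    have "Poly_Mapping.lookup (\<kappa> \<sigma>) m = (\<Sum>i\<in>A. if ?m i = m then 1 else 0)"
      unfolding \<kappa> lookup_sum character_def by (simp add: lookup_single when_def eq_commute)
    also have "\<dots> = (\<Sum>m'\<in>?m ` A. if m' = m then 1 else 0)"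
      by (simp only: sum.reindex[OF inj] o_def)
    finally show ?thesis using fin by simp
  qed
  then have keys: "Poly_Mapping.keys (\<kappa> \<sigma>) = ?m ` A"
    by (auto simp: in_keys_iff split: if_splits)
  have "(\<Prod>m\<in>Poly_Mapping.keys (\<kappa> \<sigma>).
        chern_factor (character_weight m) (Poly_Mapping.lookup (\<kappa> \<sigma>) m)) =
      (\<Prod>i\<in>A. 1 + fps_const (- var i) * fps_X)"
    unfolding keys prod.reindex[OF inj]
    by (rule prod.cong) (auto simp: lookup chern_factor_def character_weight_def)
  then show ?thesis by (simp add: equivariant_chern_def esym_def)
qed

lemma courant_flag:
  assumes "\<sigma> permutes {1..n}"
  shows "courant n (\<sigma> ` {1..i}) \<sigma> = var (\<sigma> i) - (if i < n then var (\<sigma> (Suc i)) else 0)"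
  by (simp add: courant_def card_flag[OF assms] del: One_nat_def)

text \<open>The differences of consecutive coordinates telescope.\<close>

lemma sum_courant_flag:
  assumes p: "\<sigma> permutes {1..n}" and "j \<le> n"
  shows "(\<Sum>i=j..n. courant n (\<sigma> ` {1..i}) \<sigma>) = var (\<sigma> j)"
  using \<open>j \<le> n\<close>
proof (induction j rule: inc_induct)
  case base
  then show ?case by (simp add: courant_flag[OF p] del: One_nat_def)
next
  case (step j)
  have "{j..n} = insert j {Suc j..n}" using step.hyps by auto
  then show ?case using step by (simp add: courant_flag[OF p] del: One_nat_def)
qed

text \<open>On the cone of \<open>\<sigma>\<close> only the sets of its flag have nonzero Courant
  function. The remaining sum over chains in the flag is \<open>chain_sum_flag\<close>, whose tail
  sums are the coordinates.\<close>

lemma subst_chain_polynomial: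
  assumes p: "\<sigma> permutes {1..n}" and A: "A \<subseteq> {1..n}"
    and \<rho>: "\<And>i. i \<le> n \<Longrightarrow> \<rho> (\<sigma> ` {1..i}) = card (A \<inter> \<sigma> ` {1..i})"
  shows "subst (\<lambda>S. courant n S \<sigma>)
      (\<Sum>(Ss, ps)\<in>exponent_chains n k. of_int (alpha \<rho> Ss ps) * chain_monomial Ss ps) =
    esym A (\<lambda>i. - var i) k"
proof -
  let ?y = "\<lambda>S. courant n S \<sigma>"
  let ?F = "\<lambda>i. \<sigma> ` {1..i}"
  \<comment> \<open>\<open>A\<close> is transported from elements to their positions in the order
    given by \<open>\<sigma>\<close>.\<close>
  define J where "J = \<sigma> -` A"
  have inj: "inj \<sigma>" using p by (rule permutes_inj)
  have im: "\<sigma> ` {1..n} = {1..n}" using p by (rule permutes_image)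
  have JA: "\<sigma> ` (J \<inter> {1..i}) = A \<inter> ?F i" for i by (auto simp: J_def)
  have "subst ?y (\<Sum>(Ss, ps)\<in>exponent_chains n k. of_int (alpha \<rho> Ss ps) * chain_monomial Ss ps) =
      chain_sum \<rho> ?y (nonempty_subsets n) k"
    unfolding chain_sum_def exponent_chains_def weighted_chains_def[symmetric]
    by (simp add: subst_sum subst_mult chain_monomial_def subst_prod subst_power case_prod_unfold)
  also have "\<dots> = chain_sum \<rho> ?y (?F ` {1..n}) k"
  proof (rule chain_sum_mono_neutral)
    show "finite (nonempty_subsets n)"
      by (rule finite_subset[of _ "Pow {1..n}"]) (auto simp: nonempty_subsets_def)
    show "?F ` {1..n} \<subseteq> nonempty_subsets n"
      using permutes_in_image[OF p] by (fastforce simp: nonempty_subsets_def)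
    fix T assume T: "T \<in> nonempty_subsets n - ?F ` {1..n}"
    then have "T \<subseteq> {1..n}" "T \<noteq> {}" by (auto simp: nonempty_subsets_def)
    then have "card T \<le> card {1..n}" "T \<noteq> {}" "finite T"
      by (auto intro: card_mono[OF finite_atLeastAtMost] finite_subset simp del: card_atLeastAtMost)
    then have "card T \<in> {1..n}" by (simp add: Suc_le_eq card_gt_0_iff)
    \<comment> \<open>\<open>courant\<close> tests a set only against the initial segment of its own
      size, which lies in the flag.\<close>
    then have "T \<noteq> ?F (card T)" using T by blast
    then show "?y T = 0" by (simp add: courant_def)
  qed
  also have "\<dots> = esym (J \<inter> {1..n}) (\<lambda>j. - (\<Sum>i=j..n. ?y (?F i))) k"
  proof (rule chain_sum_flag)
    show "?F i \<subset> ?F j" if "1 \<le> i" "i < j" "j \<le> n" for i j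
    proof -
      have "{1..i} \<subset> {1..j}" using that by auto
      then show ?thesis using inj by (metis image_strict_mono inj_on_subset subset_UNIV)
    qed
    show "\<rho> (?F i) = card (J \<inter> {1..i})" if "1 \<le> i" "i \<le> n" for i
      using \<rho>[OF that(2)] card_image[OF inj_on_subset[OF inj], of "J \<inter> {1..i}"]
      by (simp add: JA del: One_nat_def)
  qed simp
  also have "\<dots> = esym (J \<inter> {1..n}) (\<lambda>j. - var (\<sigma> j)) k"
    unfolding esym_def
    by (intro arg_cong2[where f = fps_nth] prod.cong) (auto simp: sum_courant_flag[OF p] simp del: One_nat_def)
  also have "\<dots> = esym (\<sigma> ` (J \<inter> {1..n})) (\<lambda>i. - var i) k"
    by (simp only: esym_def prod.reindex[OF inj_on_subset[OF inj subset_UNIV]] o_def)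
  also have "\<sigma> ` (J \<inter> {1..n}) = A" unfolding JA im using A by blast
  finally show ?thesis .
qed

section \<open>Homogeneity of the chain polynomial\<close>

lemma homogeneous_sum:
  "(\<And>a. a \<in> A \<Longrightarrow> homogeneous k (f a)) \<Longrightarrow> homogeneous k (sum f A)"
  using keys_sum[of f A] unfolding homogeneous_def by blast

lemma homogeneous_mult:
  assumes "homogeneous k f" "homogeneous l g"
  shows "homogeneous (k + l) (f * g)"
proof -
  let ?deg = "\<lambda>m :: 'a \<Rightarrow>\<^sub>0 nat. \<Sum>v\<in>Poly_Mapping.keys m. Poly_Mapping.lookup m v"
  have deg: "?deg (a + b) = ?deg a + ?deg b" for a b
  proof -
    let ?A = "Poly_Mapping.keys a \<union> Poly_Mapping.keys b"
    have "?deg c = (\<Sum>v\<in>?A. Poly_Mapping.lookup c v)" if "c \<in> {a, b, a + b}" for c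
      by (rule sum.mono_neutral_left) (use that keys_add[of a b] in \<open>auto simp: in_keys_iff\<close>)
    from this[of a] this[of b] this[of "a + b"] show ?thesis
      by (simp add: lookup_add sum.distrib)
  qed
  show ?thesis unfolding homogeneous_def
  proof
    fix m assume "m \<in> Poly_Mapping.keys (f * g)"
    then obtain a b where "m = a + b" "a \<in> Poly_Mapping.keys f" "b \<in> Poly_Mapping.keys g"
      using keys_mult[of f g] by blast
    then show "?deg m = k + l" using assms by (simp add: homogeneous_def deg)
  qed
qed

lemma homogeneous_of_int: "homogeneous 0 (of_int c)"
  by (simp add: of_int_poly_mapping homogeneous_def)

lemma homogeneous_power: "homogeneous k f \<Longrightarrow> homogeneous (p * k) (f ^ p)"
  by (induction p) (use homogeneous_of_int[of 1] homogeneous_mult in auto)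

lemma homogeneous_prod:
  "(\<And>a. a \<in> A \<Longrightarrow> homogeneous (d a) (f a)) \<Longrightarrow> homogeneous (sum d A) (prod f A)"
  by (induction A rule: infinite_finite_induct)
    (use homogeneous_of_int[of 1] in \<open>auto intro: homogeneous_mult\<close>)

lemma homogeneous_chain_monomial:
  assumes "length ps = length Ss"
  shows "homogeneous (sum_list ps) (chain_monomial Ss ps)"
proof -
  have "homogeneous 1 (var S)" for S :: "nat set" by (simp add: homogeneous_def var_def)
  then have "homogeneous (\<Sum>i<length Ss. ps ! i) (chain_monomial Ss ps)"
    unfolding chain_monomial_def using homogeneous_power[of 1] by (intro homogeneous_prod) force
  then show ?thesis using assms by (simp add: sum_list_sum_nth atLeast0LessThan)
qed

text \<open>Covers sub and quotient classes at once: a sum of inverse characters over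
  \<open>A \<sigma>\<close> enters only through the sizes of the intersections of
  \<open>A \<sigma>\<close> with the initial segments.\<close>

lemma chern_class_character_sum:
  assumes A: "\<And>\<sigma>. \<sigma> permutes {1..n} \<Longrightarrow> A \<sigma> \<subseteq> {1..n}"
    and \<kappa>: "\<And>\<sigma>. \<kappa> \<sigma> = (\<Sum>i\<in>A \<sigma>. character i (-1))"
    and \<rho>: "\<And>\<sigma> i. \<sigma> permutes {1..n} \<Longrightarrow> i \<le> n \<Longrightarrow>
      \<rho> (\<sigma> ` {1..i}) = card (A \<sigma> \<inter> \<sigma> ` {1..i})"
  shows "chern_class n k \<kappa> = chow_residue n (\<Sum>(Ss, ps)\<in>exponent_chains n k.
      of_int (alpha \<rho> Ss ps) * chain_monomial Ss ps)" (is "_ = chow_residue n ?f")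
    and "chern_class n k \<kappa> \<in> chow_graded n k"
proof -
  have f: "?f \<in> carrier (x_ring n)"
    unfolding chain_monomial_def
    by (intro poly_ring_sum)
      (auto simp: exponent_chains_def subset_iff
        intro!: poly_ring_mult poly_ring_const poly_ring_prod poly_ring_power var_in_poly_ring)
  show eq: "chern_class n k \<kappa> = chow_residue n ?f"
    unfolding chern_class_def
  proof (rule nonequivariant_eqI[OF f])
    fix \<sigma> assume p: "\<sigma> permutes {1..n}"
    then have "finite (A \<sigma>)" using A finite_subset by blast
    then show "subst (\<lambda>S. courant n S \<sigma>) ?f = equivariant_chern k \<kappa> \<sigma>"
      by (simp only: subst_chain_polynomial[OF p A[OF p] \<rho>[OF p]]
          equivariant_chern_character_sum[OF _ \<kappa>])
  qed
  have "homogeneous k (of_int c * chain_monomial Ss ps)" if "(Ss, ps) \<in> exponent_chains n k" for c Ss ps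
    using homogeneous_mult[OF homogeneous_of_int homogeneous_chain_monomial[of ps Ss]] that
    by (auto simp: exponent_chains_def)
  then have "homogeneous k ?f" by (intro homogeneous_sum) auto
  then show "chern_class n k \<kappa> \<in> chow_graded n k"
    unfolding eq chow_graded_def using f by blast
qed

theorem theorem3p1:
  fixes n r :: nat and I :: "nat set set"
  assumes "matroid {1..n} I" and "rank I {1..n} = r"
  shows "(\<forall>k\<le>r.
            chern_class n k (taut_sub n I) =
              chow_residue n (\<Sum>(Ss, ps)\<in>exponent_chains n k.
                of_int (alpha (rank I) Ss ps) * chain_monomial Ss ps) \<and>
            chern_class n k (taut_sub n I) \<in> chow_graded n k) \<and>
         (\<forall>k\<le>n - r.
            chern_class n k (taut_quot n I) =
              chow_residue n (\<Sum>(Ss, ps)\<in>exponent_chains n k.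
                of_int (alpha (nullity I) Ss ps) * chain_monomial Ss ps) \<and>
            chern_class n k (taut_quot n I) \<in> chow_graded n k)"
proof -
  let ?B = "lex_first_basis n I"
  note M = assms(1)
  have sub: "rank I (\<sigma> ` {1..i}) = card (?B \<sigma> \<inter> \<sigma> ` {1..i})"
    if "\<sigma> permutes {1..n}" "i \<le> n" for \<sigma> i
    by (rule lex_first_basis(2)[OF M that, symmetric])
  \<comment> \<open>Nullity counts the elements of the segment outside the basis, since rank counts
    those inside.\<close>
  have quot: "nullity I (\<sigma> ` {1..i}) = card (({1..n} - ?B \<sigma>) \<inter> \<sigma> ` {1..i})"
    if p: "\<sigma> permutes {1..n}" and i: "i \<le> n" for \<sigma> i
  proof -
    have "\<sigma> ` {1..i} \<subseteq> \<sigma> ` {1..n}" using i by (intro image_mono) auto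
    then have "({1..n} - ?B \<sigma>) \<inter> \<sigma> ` {1..i} = \<sigma> ` {1..i} - (?B \<sigma> \<inter> \<sigma> ` {1..i})"
      unfolding permutes_image[OF p] by blast
    then show ?thesis
      by (simp only: nullity_def sub[OF that]) (simp add: card_Diff_subset)
  qed
  note S = chern_class_character_sum[where A = ?B and \<kappa> = "taut_sub n I" and \<rho> = "rank I",
      OF lex_first_basis_subset[OF M] taut_sub_def sub]
  note Q = chern_class_character_sum[where A = "\<lambda>\<sigma>. {1..n} - ?B \<sigma>" and \<kappa> = "taut_quot n I"
      and \<rho> = "nullity I", OF Diff_subset taut_quot_def quot]
  show ?thesis using S Q by blast
qed

end
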